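(* For any fixed $\varepsilon>0$ there is a constant $C_\varepsilon$ such that for all real $t$, $$|\zeta(\tfrac{11}{15}+it)|\le C_\varepsilon(|t|+1)^{1/15+\varepsilon},$$ so that $\mu(\tfrac{11}{15})\le\tfrac1{15}$.
   Context: $\zeta$ is the Riemann zeta-function. The Lindelöf function $\mu(\sigma)$ is the infimum of the real numbers $a$ such that $\zeta(\sigma+it)=O(|t|^a)$ as $|t|\to\infty$. *)

theory Defs
  imports "HOL-Complex_Analysis.Complex_Analysis" "HOL-Library.Landau_Symbols"
    "HOL-Real_Asymp.Real_Asymp"
begin

definition zeta_series :: "complex \<Rightarrow> complex" where
  "zeta_series s = (\<Sum>n. 1 / of_nat (Suc n) powr s)"

text \<open>
  A function is an analytic continuation of the zeta series if it is holomorphic away from the pole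
  at 1 and agrees with the series on its half-plane of convergence.  As HOL functions are total,
  the value at the pole has to be fixed as well for the continuation to be unique.
\<close>

definition is_zeta :: "(complex \<Rightarrow> complex) \<Rightarrow> bool" where
  "is_zeta f \<longleftrightarrow> f holomorphic_on (UNIV - {1}) \<and> (\<forall>s. Re s > 1 \<longrightarrow> f s = zeta_series s) \<and> f 1 = 0"

definition zeta :: "complex \<Rightarrow> complex" where
  "zeta = (THE f. is_zeta f)"

text \<open>
  The infimum is taken in the extended reals, so that no convention for infima of
  sets that are empty or unbounded below enters.
\<close>

definition lindelof_mu :: "real \<Rightarrow> ereal" where
  "lindelof_mu \<sigma> = Inf (ereal ` {a. (\<lambda>t::real. norm (zeta (complex_of_real \<sigma> + \<i> * complex_of_real t)))
                                      \<in> O[at_infinity](\<lambda>t. \<bar>t\<bar> powr a)})"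

text \<open>
  Existence of the continuation: expanding \<open>(n+1) powr (1-s)\<close> around \<open>n\<close> to order \<open>K\<close> and summing over \<open>n\<close>
  expresses \<open>(s-1) * zeta s\<close> through its values at \<open>s+1, \<dots>, s+K-1\<close> and a series that
  converges for \<open>Re s > 1 - K\<close>.
\<close>

definition fall :: "complex \<Rightarrow> nat \<Rightarrow> complex" where
  "fall s j = (\<Prod>i<j. 1 - s - of_nat i)"

definition taylor_rem :: "nat \<Rightarrow> nat \<Rightarrow> complex \<Rightarrow> complex" where
  "taylor_rem K n s = (of_nat n + 1) powr (1 - s) - (\<Sum>j\<le>K. fall s j * of_nat n powr (1 - s - of_nat j) / fact j)"

lemma taylor_rem_bound:
  assumes n: "n \<ge> 1" and s: "Re s + real K \<ge> 0"
  shows "norm (taylor_rem K n s) \<le> norm (fall s (Suc K)) * real n powr (- Re s - real K)"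
proof -
  define S where "S = closed_segment (of_nat n :: complex) (of_nat n + 1)"
  have S: "\<exists>y. x = of_real y \<and> y \<ge> real n" if "x \<in> S" for x
  proof -
    from that obtain u where u: "0 \<le> u \<and> u \<le> 1 \<and> x = (1 - u) *\<^sub>R of_nat n + u *\<^sub>R (of_nat n + 1)"
      unfolding S_def in_segment(1) ..
    hence "x = of_real (real n + u)" by (simp add: scaleR_conv_of_real algebra_simps)
    with u show ?thesis by (intro exI[of _ "real n + u"] conjI) simp_all
  qed
  define f where "f = (\<lambda>j x. fall s j * x powr (1 - s - of_nat j))"
  have "norm (f 0 (of_nat n + 1) - (\<Sum>i\<le>K. f i (of_nat n) * (of_nat n + 1 - of_nat n) ^ i / fact i))
     \<le> (norm (fall s (Suc K)) * real n powr (- Re s - real K)) * norm (of_nat n + 1 - of_nat n :: complex) ^ Suc K / fact K"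
  proof (rule complex_Taylor[where S = S])
    show "convex S" by (simp add: S_def)
    show "(f i has_field_derivative f (Suc i) x) (at x within S)" if x: "x \<in> S" and "i \<le> K" for i x
    proof -
      obtain y where y: "x = of_real y" "y \<ge> real n" using S[OF x] by blast
      have "x \<notin> \<real>\<^sub>\<le>\<^sub>0" using y n by auto
      hence "((\<lambda>x. x powr (1 - s - of_nat i)) has_field_derivative (1 - s - of_nat i) * x powr (1 - s - of_nat i - 1)) (at x within S)"
        by (intro has_field_derivative_at_within[OF has_field_derivative_powr])
      from DERIV_cmult[OF this, of "fall s i"] show ?thesis
        by (simp add: f_def fall_def algebra_simps)
    qed
    show "norm (f (Suc K) x) \<le> norm (fall s (Suc K)) * real n powr (- Re s - real K)" if x: "x \<in> S" for x
    proof -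
      obtain y where y: "x = of_real y" "y \<ge> real n" using S[OF x] by blast
      have "norm (x powr (1 - s - of_nat (Suc K))) = y powr (- Re s - real K)"
        using y n by (subst norm_powr_real_powr) auto
      also have "\<dots> \<le> real n powr (- Re s - real K)"
        using y n s by (intro powr_mono2') auto
      finally show ?thesis unfolding f_def norm_mult by (intro mult_left_mono) auto
    qed
  qed (auto simp: S_def)
  also have "\<dots> \<le> norm (fall s (Suc K)) * real n powr (- Re s - real K)"
  proof -
    have "c / fact K \<le> c" if "c \<ge> 0" for c :: real
      using that mult_left_mono[OF fact_ge_1[of K], of c] by (simp add: divide_le_eq)
    thus ?thesis by simp
  qed
  finally show ?thesis by (simp add: f_def taylor_rem_def fall_def)
qed

lemma holomorphic_fall [holomorphic_intros]: "(\<lambda>s. fall s j) holomorphic_on A"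
  unfolding fall_def by (intro holomorphic_intros)

lemma holomorphic_taylor_rem: "n \<ge> 1 \<Longrightarrow> (\<lambda>s. taylor_rem K n s) holomorphic_on A"
  unfolding taylor_rem_def
  by (intro holomorphic_intros) (auto simp: add_eq_0_iff simp flip: of_nat_Suc)

definition rem_series :: "nat \<Rightarrow> complex \<Rightarrow> complex" where
  "rem_series K s = (\<Sum>n. taylor_rem K (Suc n) s)"

lemma rem_series_holomorphic: "rem_series K holomorphic_on {s. Re s > 1 - real K}"
proof (rule holomorphic_uniform_sequence)
  show "open {s. Re s > 1 - real K}" by (rule open_halfspace_Re_gt)
  show "(\<lambda>s. \<Sum>n<N. taylor_rem K (Suc n) s) holomorphic_on {s. Re s > 1 - real K}" for N
    by (intro holomorphic_on_sum holomorphic_taylor_rem) auto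
  fix z assume z: "z \<in> {s. Re s > 1 - real K}"
  define d where "d = (Re z - (1 - real K)) / 2"
  define e where "e = 1 - real K + d"
  have d: "d > 0" using z by (simp add: d_def)
  have ball: "Re s \<ge> e" if "s \<in> cball z d" for s
  proof -
    have "\<bar>Re (z - s)\<bar> \<le> d" using that abs_Re_le_cmod[of "z - s"] by (simp add: dist_norm)
    hence "Re s \<ge> Re z - d" by simp
    moreover have "2 * d = Re z - (1 - real K)" by (simp add: d_def)
    ultimately show ?thesis unfolding e_def by argo
  qed
  have "compact ((\<lambda>s. fall s (Suc K)) ` cball z d)"
    by (intro compact_continuous_image holomorphic_on_imp_continuous_on holomorphic_fall) auto
  hence "bounded ((\<lambda>s. fall s (Suc K)) ` cball z d)" by (rule compact_imp_bounded)
  then obtain B where "\<forall>x\<in>(\<lambda>s. fall s (Suc K)) ` cball z d. norm x \<le> B"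
    unfolding bounded_iff ..
  hence B: "norm (fall s (Suc K)) \<le> B" if "s \<in> cball z d" for s using that by blast
  have "summable (\<lambda>n. real n powr (- e - real K))"
    using d by (subst summable_real_powr_iff) (simp add: e_def)
  hence sm: "summable (\<lambda>n. B * real (Suc n) powr (- e - real K))"
    by (intro summable_mult) (subst summable_Suc_iff, assumption)
  have "uniform_limit (cball z d) (\<lambda>N s. \<Sum>n<N. taylor_rem K (Suc n) s) (rem_series K) sequentially"
    unfolding rem_series_def
  proof (rule Weierstrass_m_test[OF _ sm])
    fix n s assume s: "s \<in> cball z d"
    have "norm (taylor_rem K (Suc n) s) \<le> norm (fall s (Suc K)) * real (Suc n) powr (- Re s - real K)"
      using ball[OF s] d by (intro taylor_rem_bound) (auto simp: e_def)
    also have "\<dots> \<le> B * real (Suc n) powr (- e - real K)"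
      using ball[OF s] B[OF s] order_trans[OF norm_ge_zero B[OF s]]
      by (intro mult_mono powr_mono) simp_all
    finally show "norm (taylor_rem K (Suc n) s) \<le> B * real (Suc n) powr (- e - real K)" .
  qed
  moreover have "cball z d \<subseteq> {s. Re s > 1 - real K}" 
  proof
    fix s assume "s \<in> cball z d"
    from ball[OF this] d show "s \<in> {s. Re s > 1 - real K}" by (simp add: e_def)
  qed
  ultimately show "\<exists>d>0. cball z d \<subseteq> {s. Re s > 1 - real K} \<and>
      uniform_limit (cball z d) (\<lambda>N s. \<Sum>n<N. taylor_rem K (Suc n) s) (rem_series K) sequentially"
    using d by (intro exI[of _ d] conjI)
qed

lemma zeta_series_sums:
  assumes "Re s > 1"
  shows "(\<lambda>n. of_nat (Suc n) powr (-s)) sums zeta_series s"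
proof -
  have "summable (\<lambda>n. real n powr (- Re s))" using assms by (subst summable_real_powr_iff) simp
  hence "summable (\<lambda>n. real (Suc n) powr (- Re s))" by (subst summable_Suc_iff)
  moreover have norm_eq: "norm ((of_nat (Suc n) :: complex) powr (-s)) = real (Suc n) powr (- Re s)" for n
    by (subst norm_powr_real_powr) auto
  ultimately have "summable (\<lambda>n. of_nat (Suc n) powr (-s))"
    by (simp only: norm_eq summable_norm_cancel[of "\<lambda>n. of_nat (Suc n) powr (-s)"])
  thus ?thesis unfolding zeta_series_def powr_minus_divide by (rule summable_sums)
qed

lemma fall_Suc: "fall s (Suc j) = fall s j * (1 - s - of_nat j)"
  by (simp add: fall_def)

lemma rem_series_eq:
  assumes "Re s > 1"
  shows "rem_series K s = -1 + (\<Sum>j<K. fall s j / fact (Suc j) * ((s + of_nat j - 1) * zeta_series (s + of_nat j)))"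
proof -
  have lim: "(\<lambda>n. of_nat (Suc n) powr (1 - s)) \<longlonglongrightarrow> 0"
  proof (rule tendsto_norm_zero_cancel)
    have "(\<lambda>n. real (Suc n) powr (1 - Re s)) \<longlonglongrightarrow> 0"
      using assms by real_asymp
    moreover have "norm ((of_nat (Suc n) :: complex) powr (1 - s)) = real (Suc n) powr (1 - Re s)" for n
      by (subst norm_powr_real_powr) auto
    ultimately show "(\<lambda>n. norm (of_nat (Suc n) powr (1 - s))) \<longlonglongrightarrow> 0" by (simp only:)
  qed
  have tele: "(\<lambda>n. of_nat (Suc (Suc n)) powr (1 - s) - of_nat (Suc n) powr (1 - s)) sums (0 - of_nat (Suc 0) powr (1 - s))"
    by (rule telescope_sums[OF lim])
  have "(\<lambda>n. (of_nat (Suc (Suc n)) powr (1 - s) - of_nat (Suc n) powr (1 - s))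
          - (\<Sum>j<K. fall s (Suc j) / fact (Suc j) * of_nat (Suc n) powr (-(s + of_nat j))))
        sums ((0 - of_nat (Suc 0) powr (1 - s)) - (\<Sum>j<K. fall s (Suc j) / fact (Suc j) * zeta_series (s + of_nat j)))"
    using assms by (intro sums_diff tele sums_sum sums_mult zeta_series_sums) auto
  also have "(\<lambda>n. (of_nat (Suc (Suc n)) powr (1 - s) - of_nat (Suc n) powr (1 - s))
          - (\<Sum>j<K. fall s (Suc j) / fact (Suc j) * of_nat (Suc n) powr (-(s + of_nat j))))
      = (\<lambda>n. taylor_rem K (Suc n) s)"
  proof
    fix n
    have *: "{..K} = insert 0 (Suc ` {..<K})"
      by (metis lessThan_Suc_atMost lessThan_Suc_eq_insert_0)
    have "(\<Sum>j\<le>K. fall s j * of_nat (Suc n) powr (1 - s - of_nat j) / fact j) =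
        of_nat (Suc n) powr (1 - s) + (\<Sum>j<K. fall s (Suc j) * of_nat (Suc n) powr (1 - s - of_nat (Suc j)) / fact (Suc j))"
      unfolding * by (subst sum.insert) (auto simp: sum.reindex fall_def)
    moreover have "1 - s - of_nat (Suc j) = -(s + of_nat j)" for j by simp
    moreover have "of_nat (Suc (Suc n)) = (of_nat (Suc n) + 1 :: complex)" by simp
    ultimately show "(of_nat (Suc (Suc n)) powr (1 - s) - of_nat (Suc n) powr (1 - s))
          - (\<Sum>j<K. fall s (Suc j) / fact (Suc j) * of_nat (Suc n) powr (-(s + of_nat j))) = taylor_rem K (Suc n) s"
      unfolding taylor_rem_def by (simp only: diff_diff_eq times_divide_eq_left)
  qed
  finally have "rem_series K s = (0 - of_nat (Suc 0) powr (1 - s)) - (\<Sum>j<K. fall s (Suc j) / fact (Suc j) * zeta_series (s + of_nat j))"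
    unfolding rem_series_def by (simp only: sums_iff)
  also have "\<dots> = -1 + (\<Sum>j<K. - (fall s (Suc j) / fact (Suc j) * zeta_series (s + of_nat j)))"
    by (simp add: sum_negf)
  also have "(\<Sum>j<K. - (fall s (Suc j) / fact (Suc j) * zeta_series (s + of_nat j))) =
      (\<Sum>j<K. fall s j / fact (Suc j) * ((s + of_nat j - 1) * zeta_series (s + of_nat j)))"
    by (intro sum.cong refl) (simp add: fall_Suc divide_simps, simp add: algebra_simps)
  finally show ?thesis .
qed

lemma continuation_to_halfplane:
  "\<exists>F. (K \<ge> 1 \<longrightarrow> F holomorphic_on {s. Re s > 1 - real K}) \<and> (\<forall>s. Re s > 1 \<longrightarrow> F s = (s - 1) * zeta_series s)"
proof (induction K)
  case 0
  show ?case by auto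
next
  case (Suc K)
  then obtain F where F: "K \<ge> 1 \<Longrightarrow> F holomorphic_on {s. Re s > 1 - real K}"
    "\<And>s. Re s > 1 \<Longrightarrow> F s = (s - 1) * zeta_series s" by blast
  define G where "G = (\<lambda>s. 1 + rem_series (Suc K) s - (\<Sum>j<K. fall s (Suc j) / fact (Suc (Suc j)) * F (s + of_nat (Suc j))))"
  have "G holomorphic_on {s. Re s > 1 - real (Suc K)}"
  proof -
    have "(\<lambda>s. F (s + of_nat (Suc j))) holomorphic_on {s. Re s > 1 - real (Suc K)}" if "j < K" for j
    proof -
      have "F \<circ> (\<lambda>s. s + of_nat (Suc j)) holomorphic_on {s. Re s > 1 - real (Suc K)}"
        using that by (intro holomorphic_on_compose_gen[OF _ F(1)] holomorphic_intros) auto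
      thus ?thesis by (simp add: o_def)
    qed
    thus ?thesis unfolding G_def
      by (intro holomorphic_intros rem_series_holomorphic) auto
  qed
  moreover have "G s = (s - 1) * zeta_series s" if s: "Re s > 1" for s
  proof -
    have "F (s + of_nat (Suc j)) = (s + of_nat (Suc j) - 1) * zeta_series (s + of_nat (Suc j))" for j
      using s by (subst F(2)) auto
    thus ?thesis unfolding G_def rem_series_eq[OF s]
      by (subst sum.lessThan_Suc_shift) (simp add: fall_def)
  qed
  ultimately show ?case by blast
qed

lemma halfplane_nonempty: "{s. Re s > 1} \<noteq> {}"
proof -
  have "2 \<in> {s. Re s > 1}" by simp
  thus ?thesis by blast
qed

lemma entire_continuation:
  "\<exists>Z. Z holomorphic_on UNIV \<and> (\<forall>s. Re s > 1 \<longrightarrow> Z s = (s - 1) * zeta_series s)"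
proof -
  have "\<forall>K. \<exists>F. F holomorphic_on {s. Re s > - real K} \<and> (\<forall>s. Re s > 1 \<longrightarrow> F s = (s - 1) * zeta_series s)"
  proof
    fix K show "\<exists>F. F holomorphic_on {s. Re s > - real K} \<and> (\<forall>s. Re s > 1 \<longrightarrow> F s = (s - 1) * zeta_series s)"
      using continuation_to_halfplane[of "Suc K"] by simp
  qed
  then obtain F where F: "\<And>K. F K holomorphic_on {s. Re s > - real K}"
      "\<And>K s. Re s > 1 \<Longrightarrow> F K s = (s - 1) * zeta_series s" by metis
  have eq: "F K s = F L s" if "K \<le> L" "Re s > - real K" for K L s
  proof (rule analytic_continuation_open[of "{s. Re s > 1}" "{s. Re s > - real K}" "F K" "F L"])
    show "open {s. Re s > 1}" "open {s. Re s > - real K}" by (rule open_halfspace_Re_gt)+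
    show "connected {s. Re s > - real K}" by (intro convex_connected convex_halfspace_Re_gt)
    show "{s. Re s > 1} \<noteq> {}" using halfplane_nonempty .
    show "F L holomorphic_on {s. Re s > - real K}"
      by (rule holomorphic_on_subset[OF F(1)]) (use that in auto)
  qed (use F that in auto)
  define Z where "Z = (\<lambda>s. F (nat \<lceil>\<bar>Re s\<bar>\<rceil> + 1) s)"
  have Z: "Z s = F K s" if "Re s > - real K" for K s
  proof -
    have "Re s > - real (nat \<lceil>\<bar>Re s\<bar>\<rceil> + 1)" by linarith
    thus ?thesis unfolding Z_def using eq that by (metis nat_le_linear)
  qed
  have "Z holomorphic_on (\<Union>K. {s. Re s > - real K})"
  proof (rule holomorphic_on_UN_open)
    show "Z holomorphic_on {s. Re s > - real K}" for K
      using F(1)[of K] by (rule holomorphic_transform) (simp add: Z)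
  qed (rule open_halfspace_Re_gt)
  moreover have "(\<Union>K. {s. Re s > - real K}) = UNIV"
    using reals_Archimedean2 by (auto, metis add.inverse_inverse neg_less_iff_less)
  ultimately have "Z holomorphic_on UNIV" by simp
  moreover have "Z s = (s - 1) * zeta_series s" if "Re s > 1" for s
    using that Z[of 0 s] F(2) by simp
  ultimately show ?thesis by blast
qed

theorem ex1_zeta: "\<exists>!f. is_zeta f"
proof (rule ex_ex1I)
  obtain Z where Z: "Z holomorphic_on UNIV" "\<And>s. Re s > 1 \<Longrightarrow> Z s = (s - 1) * zeta_series s"
    using entire_continuation by blast
  define f where "f = (\<lambda>s. if s = 1 then 0 else Z s / (s - 1))"
  have "(\<lambda>s. Z s / (s - 1)) holomorphic_on (UNIV - {1})"
    by (intro holomorphic_intros holomorphic_on_subset[OF Z(1)]) auto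
  hence "f holomorphic_on (UNIV - {1})"
    by (rule holomorphic_transform) (auto simp: f_def)
  moreover have "f s = zeta_series s" if "Re s > 1" for s
    using that Z(2)[of s] by (auto simp: f_def)
  ultimately show "\<exists>f. is_zeta f" unfolding is_zeta_def by (intro exI[of _ f]) (auto simp: f_def)
next
  fix f g assume fg: "is_zeta f" "is_zeta g"
  have "f s = g s" if "s \<noteq> 1" for s
  proof (rule analytic_continuation_open[of "{s. Re s > 1}" "UNIV - {1}" f g])
    show "open {s. Re s > 1}" by (rule open_halfspace_Re_gt)
    show "connected (UNIV - {1::complex})"
      using connected_punctured_universe[of "1::complex"] by (simp add: Compl_eq_Diff_UNIV)
    show "{s. Re s > 1} \<noteq> {}" using halfplane_nonempty .
  qed (use fg that in \<open>auto simp: is_zeta_def\<close>)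
  moreover have "f 1 = g 1" using fg by (simp add: is_zeta_def)
  ultimately show "f = g" by (intro ext) metis
qed

lemma zeta_is_zeta: "is_zeta zeta"
  unfolding zeta_def by (rule theI'[OF ex1_zeta])

end

theory Submission
  imports Defs
begin

text \<open>
  Up to a bounded error, \<open>zeta s\<close> with \<open>Re s = 11/15\<close> and \<open>\<bar>Im s\<bar> = t \<ge> 1\<close> is the Dirichlet polynomial
  \<open>\<Sum>n<N. n powr (-s)\<close> with \<open>N\<close> between \<open>t\<^sup>2\<close> and \<open>2 * t\<^sup>2\<close> (lemma \<open>zeta_approx\<close>).
  Cut it into \<open>O(log t)\<close> dyadic blocks \<open>M \<le> n < 2 * M\<close>.  In each block the factor \<open>n powr (-11/15)\<close> comes
  out by partial summation, and what remains is an exponential sum \<open>\<Sum>n. exp (2 * pi * \<i> * f n)\<close> with phase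
  \<open>f n = t / (2 * pi) * ln n\<close>, whose \<open>k\<close>-th differences have size about \<open>t / M ^ k\<close>.  The theorem follows
  once each block is \<open>O(t powr (1/15))\<close>, because the logarithm is absorbed by \<open>t powr \<epsilon>\<close>.

  Van der Corput's estimates for \<open>k\<close>-th differences of size \<open>\<mu>\<close> bound a sum of length \<open>M\<close> by
  \<open>M * \<mu> powr \<kappa> + M powr \<beta> * \<mu> powr (-\<kappa>)\<close> with \<open>(\<kappa>, \<beta>)\<close> equal to \<open>(1/2, 0)\<close>, \<open>(1/6, 1/2)\<close> and
  \<open>(1/14, 3/4)\<close> for \<open>k = 2, 3, 4\<close>.  A block is then small enough for \<open>M \<le> t powr (1/4)\<close> by counting its
  terms, up to \<open>t powr (3/7)\<close> by \<open>k = 4\<close>, up to \<open>t powr (3/4)\<close> by \<open>k = 3\<close> and up to \<open>t powr 2\<close> by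
  \<open>k = 2\<close> (lemma \<open>dyadic_block_bound\<close>).  At \<open>M = t powr (1/4)\<close> both the count and the case \<open>k = 4\<close> give
  exactly \<open>t powr (1/15)\<close>: the abscissa \<open>11/15\<close> is the one at which these two estimates
  balance.

  The case \<open>k = 2\<close> (lemma \<open>vdc_second_difference\<close>) rests on the Kusmin--Landau inequality for sums
  whose phase increments stay away from the integers.  The passage from \<open>k\<close> to \<open>k + 1\<close> (lemma
  \<open>vdc_bound_step\<close>) is Weyl differencing: the differenced phase \<open>f (n + d) - f n\<close> has \<open>k\<close>-th
  differences of size \<open>d * \<mu>\<close>.  Everything is phrased with finite differences instead of
  derivatives, since these are what the two inequalities see; derivatives of the logarithm enter
  only once, through the mean value theorem.
\<close>

section \<open>Sums with slowly varying phase increments\<close>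

definition ee :: "real \<Rightarrow> complex" where "ee x = cis (2 * pi * x)"

lemma norm_ee [simp]: "norm (ee x) = 1"
  by (simp add: ee_def)

lemma ee_add: "ee (x + y) = ee x * ee y"
  by (simp add: ee_def cis_mult algebra_simps)

lemma ee_minus: "ee (- x) = cnj (ee x)"
  by (simp add: ee_def cis_cnj)

lemma ee_diff: "ee (x - y) = ee x * cnj (ee y)"
  using ee_add[of x "- y"] by (simp add: ee_minus)

lemma ee_of_int [simp]: "ee (of_int j) = 1"
  unfolding ee_def using cis_multiple_2pi[of "of_int j"] by simp

lemma norm_sum_ee_uminus: "norm (\<Sum>n\<in>A. ee (- f n)) = norm (\<Sum>n\<in>A. ee (f n))"
proof -
  have "(\<Sum>n\<in>A. ee (- f n)) = cnj (\<Sum>n\<in>A. ee (f n))" by (simp add: ee_minus)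
  thus ?thesis by (simp only: complex_mod_cnj)
qed

text \<open>Concavity of the sine puts it above its chord on \<open>[0, pi/2]\<close>; the rest is symmetry about \<open>pi/2\<close>.\<close>
lemma sin_pi_ge:
  assumes "0 < \<theta>" "\<theta> \<le> x" "x \<le> 1 - \<theta>"
  shows "sin (pi * x) \<ge> 2 * \<theta>"
proof -
  have jordan: "sin (pi * y) \<ge> 2 * y" if "0 \<le> y" "y \<le> 1/2" for y :: real
  proof -
    have "concave_on {0..pi} sin"
      by (rule f''_le0_imp_concave) (auto intro!: derivative_eq_intros sin_ge_zero)
    hence "sin ((1 - 2*y) *\<^sub>R 0 + (2*y) *\<^sub>R (pi/2)) \<ge> (1 - 2*y) * sin 0 + (2*y) * sin (pi/2)"
      using that unfolding concave_on_def by (intro concave_onD) (auto simp: concave_on_def)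
    thus ?thesis by (simp add: algebra_simps)
  qed
  show ?thesis
  proof (cases "x \<le> 1/2")
    case True
    thus ?thesis using jordan[of x] assms by linarith
  next
    case False
    have "sin (pi * x) = sin (pi * (1 - x))" by (simp add: algebra_simps sin_diff)
    thus ?thesis using jordan[of "1 - x"] assms False by auto
  qed
qed

text \<open>
  The points \<open>1 / (1 - ee x)\<close> lie on the vertical line of real part \<open>1/2\<close>.  Hence a monotone movement of
  \<open>x\<close> moves them monotonically along a line, and total variations telescope.
\<close>
lemma inverse_one_minus_ee:
  assumes "sin (pi * x) \<noteq> 0"
  shows "1 / (1 - ee x) = 1/2 + \<i>/2 * of_real (cot (pi * x))" "1 - ee x \<noteq> 0"
proof -
  have d: "ee x = cis (pi * x) * cis (pi * x)"
    by (simp add: ee_def cis_mult mult.assoc)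
  have sc: "(sin (pi*x))\<^sup>2 + (cos (pi*x))\<^sup>2 = 1" by simp
  have e: "1 - ee x = - 2 * \<i> * of_real (sin (pi*x)) * cis (pi*x)"
    unfolding d using sc by (simp add: complex_eq_iff power2_eq_square; algebra)
  show "1 - ee x \<noteq> 0" unfolding e using assms by simp
  have "(1/2 + \<i>/2 * of_real (cot (pi * x))) * of_real (sin (pi*x)) = \<i>/2 * cis (- (pi*x))"
    using assms by (simp add: cot_def complex_eq_iff)
  moreover have "a * (- 2 * \<i> * b * c) = (a * b) * (- 2 * \<i> * c)" for a b c :: complex
    by simp
  ultimately have "(1/2 + \<i>/2 * of_real (cot (pi * x))) * (1 - ee x) = \<i>/2 * cis (-(pi*x)) * (- 2 * \<i> * cis (pi*x))"
    unfolding e by (simp only:)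
  also have "\<dots> = 1" by (simp add: cis_mult mult_ac)
  finally show "1 / (1 - ee x) = 1/2 + \<i>/2 * of_real (cot (pi * x))"
    using \<open>1 - ee x \<noteq> 0\<close> by (metis nonzero_eq_divide_eq)
qed

lemma cot_decreasing:
  assumes "0 < x" "x \<le> y" "y < pi"
  shows "cot y \<le> cot x"
proof (cases "x = y")
  case False
  have "0 < sin x" "0 < sin y" "0 \<le> sin (y - x)" using assms by (auto intro!: sin_gt_zero sin_ge_zero)
  moreover from this have "cot x - cot y = sin (y - x) / (sin x * sin y)"
    by (simp add: cot_def sin_diff field_simps)
  ultimately have "cot x - cot y \<ge> 0" by simp
  thus ?thesis by simp
qed auto

lemma sum_by_parts:
  fixes c e :: "nat \<Rightarrow> 'a::comm_ring"
  shows "(\<Sum>n<Suc m. c n * (e n - e (Suc n))) =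
    c 0 * e 0 - c m * e (Suc m) + (\<Sum>n<m. (c (Suc n) - c n) * e (Suc n))"
  by (induction m) (simp_all add: algebra_simps)

text \<open>
  With \<open>c n = 1 / (1 - ee (f (n + 1) - f n))\<close> each term is \<open>ee (f n) = c n * (ee (f n) - ee (f (n + 1)))\<close>, so the sum
  would telescope if \<open>c\<close> were constant.  Summation by parts leaves the total variation of \<open>c\<close>, which for
  monotone increments is the distance of its end values, and both of these are \<open>O(1 / \<theta>)\<close>.
\<close>
lemma kusmin_landau:
  fixes f :: "nat \<Rightarrow> real" and j :: int
  assumes \<theta>: "0 < \<theta>"
    and g: "\<And>n. n < m \<Longrightarrow> of_int j + \<theta> \<le> f (Suc n) - f n \<and> f (Suc n) - f n \<le> of_int j + 1 - \<theta>"
    and mono: "\<And>n. Suc n < m \<Longrightarrow> f (Suc n) - f n \<le> f (Suc (Suc n)) - f (Suc n)"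
  shows "norm (\<Sum>n<m. ee (f n)) \<le> 1 / \<theta>"
proof (cases m)
  case 0
  thus ?thesis using \<theta> by simp
next
  case (Suc k)
  define g where "g n = f (Suc n) - f n - of_int j" for n
  have g1: "\<theta> \<le> g n" "g n \<le> 1 - \<theta>" if "n < m" for n
    using assms(2)[OF that] by (auto simp: g_def)
  have s: "sin (pi * g n) \<ge> 2 * \<theta>" if "n < m" for n
    using sin_pi_ge[OF \<theta> g1[OF that]] .
  define c where "c n = 1/2 + \<i>/2 * of_real (cot (pi * g n))" for n
  have cotb: "\<bar>cot (pi * g n)\<bar> \<le> 1 / (2*\<theta>)" if "n < m" for n
  proof -
    have "\<bar>cot (pi * g n)\<bar> = \<bar>cos (pi * g n)\<bar> / sin (pi * g n)"
      using s[OF that] \<theta> by (simp add: cot_def)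
    also have "\<dots> \<le> 1 / (2*\<theta>)" using s[OF that] \<theta> by (intro frac_le) auto
    finally show ?thesis .
  qed
  have c_eq: "c n = 1 / (1 - ee (g n))" "1 - ee (g n) \<noteq> 0" if "n < m" for n
    using inverse_one_minus_ee[of "g n"] s[OF that] \<theta> unfolding c_def by auto
  have c_bd: "norm (c n) \<le> 1 / (4*\<theta>)" if "n < m" for n
  proof -
    have "(norm (c n))\<^sup>2 = 1/4 + (cot (pi * g n))\<^sup>2 / 4"
      unfolding c_def cmod_power2 by (simp add: power_divide)
    also have "\<dots> = 1 / (2 * sin (pi * g n))\<^sup>2"
    proof -
      have "(cos (pi * g n))\<^sup>2 = 1 - (sin (pi * g n))\<^sup>2" using sin_cos_squared_add[of "pi * g n"] by linarith
      thus ?thesis using s[OF that] \<theta> by (simp add: cot_def field_simps)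
    qed
    also have "\<dots> \<le> 1 / (4*\<theta>)\<^sup>2"
      using s[OF that] \<theta> by (intro frac_le power_mono) auto
    finally have "(norm (c n))\<^sup>2 \<le> (1 / (4*\<theta>))\<^sup>2" by (simp add: power_divide)
    thus ?thesis using \<theta> by (rule_tac power2_le_imp_le) auto
  qed
  have step: "ee (f n) = c n * (ee (f n) - ee (f (Suc n)))" if "n < m" for n
  proof -
    have "f (Suc n) = f n + (g n + of_int j)" by (simp add: g_def)
    hence "ee (f (Suc n)) = ee (f n) * ee (g n)" by (simp only: ee_add ee_of_int mult_1_right)
    hence "ee (f n) - ee (f (Suc n)) = ee (f n) * (1 - ee (g n))" by (simp add: algebra_simps)
    thus ?thesis using c_eq[OF that] by simp
  qed
  have "(\<Sum>n<m. ee (f n)) = (\<Sum>n<Suc k. c n * (ee (f n) - ee (f (Suc n))))"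
    unfolding Suc using step Suc by (intro sum.cong) auto
  also have "\<dots> = c 0 * ee (f 0) - c k * ee (f (Suc k)) + (\<Sum>n<k. (c (Suc n) - c n) * ee (f (Suc n)))"
    by (rule sum_by_parts)
  also have "norm \<dots> \<le> norm (c 0) + norm (c k) + (\<Sum>n<k. norm (c (Suc n) - c n))"
    by (rule norm_triangle_le, rule add_mono, rule norm_triangle_le_diff)
       (auto simp: norm_mult intro!: sum_norm_le)
  also have "(\<Sum>n<k. norm (c (Suc n) - c n)) = (\<Sum>n<k. cot (pi * g n) / 2 - cot (pi * g (Suc n)) / 2)"
  proof (rule sum.cong)
    fix n assume "n \<in> {..<k}"
    hence n: "n < m" "Suc n < m" using Suc by auto
    have "cot (pi * g (Suc n)) \<le> cot (pi * g n)"
      using g1[OF n(1)] g1[OF n(2)] mono[OF n(2)] \<theta> by (intro cot_decreasing) (auto simp: g_def)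
    moreover have "c (Suc n) - c n = \<i> * of_real ((cot (pi * g (Suc n)) - cot (pi * g n)) / 2)"
      by (simp add: c_def field_simps)
    ultimately show "norm (c (Suc n) - c n) = cot (pi * g n) / 2 - cot (pi * g (Suc n)) / 2"
      by (simp add: norm_mult del: of_real_divide of_real_diff)
  qed auto
  also have "\<dots> = cot (pi * g 0) / 2 - cot (pi * g k) / 2"
    by (rule sum_lessThan_telescope')
  also have "\<dots> \<le> 1 / (2*\<theta>)"
    using cotb[of 0] cotb[of k] Suc by simp
  also have "norm (c 0) + norm (c k) + 1 / (2*\<theta>) \<le> 1/\<theta>"
    using c_bd[of 0] c_bd[of k] Suc by (simp add: field_simps)
  finally show ?thesis by simp
qed

lemma norm_sum_ee_le: "norm (\<Sum>n\<in>A. ee (f n)) \<le> real (card A)"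
  using sum_norm_le[of A "\<lambda>n. ee (f n)" "\<lambda>_. 1"] by simp

lemma convex_nat_set_is_interval:
  fixes A :: "nat set"
  assumes "finite A" "\<And>x y z. x \<in> A \<Longrightarrow> z \<in> A \<Longrightarrow> x \<le> y \<Longrightarrow> y \<le> z \<Longrightarrow> y \<in> A"
  obtains a m where "A = {a..<a + m}"
proof (cases "A = {}")
  case True
  thus ?thesis using that[of 0 0] by simp
next
  case False
  have "A = {Min A..<Min A + (Suc (Max A) - Min A)}"
  proof (intro equalityI subsetI)
    fix y assume "y \<in> A"
    thus "y \<in> {Min A..<Min A + (Suc (Max A) - Min A)}"
      using Min_le[OF assms(1)] Max_ge[OF assms(1)] by fastforce
  next
    fix y assume "y \<in> {Min A..<Min A + (Suc (Max A) - Min A)}"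
    moreover have "Min A \<le> Max A" using Min_le[of A "Max A"] assms(1) False by auto
    ultimately show "y \<in> A"
      using assms(2)[of "Min A" "Max A" y] Min_in[OF assms(1) False] Max_in[OF assms(1) False] by auto
  qed
  thus ?thesis using that by blast
qed

lemma gap_mono:
  fixes g :: "nat \<Rightarrow> real"
  assumes "\<And>n. Suc n < m \<Longrightarrow> g n + \<mu> \<le> g (Suc n)" and "a + k < m"
  shows "g a + real k * \<mu> \<le> g (a + k)"
  using assms(2)
proof (induction k)
  case (Suc k)
  thus ?case using assms(1)[of "a + k"] by (simp add: algebra_simps)
qed simp

lemma mono_of_gap:
  fixes g :: "nat \<Rightarrow> real"
  assumes "\<And>n. Suc n < m \<Longrightarrow> g n + \<mu> \<le> g (Suc n)" and "0 \<le> \<mu>" "a \<le> b" "b < m"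
  shows "g a \<le> g b"
proof -
  have "g a + real (b - a) * \<mu> \<le> g (a + (b - a))"
    using assms by (intro gap_mono[where m = m]) auto
  thus ?thesis using assms by (smt (verit) le_add_diff_inverse mult_nonneg_nonneg of_nat_0_le_iff)
qed

text \<open>
  Increments that grow by at least \<open>\<mu>\<close> at each step spend at most \<open>\<theta> / \<mu> + 1\<close> steps within \<open>\<theta>\<close> of either
  end of \<open>[j, j + 1]\<close>.  Those terms are counted; the remaining ones fall under Kusmin--Landau.
\<close>
lemma slow_window_bound:
  fixes f :: "nat \<Rightarrow> real" and j :: int and A :: "nat set"
  defines "g \<equiv> (\<lambda>n. f (Suc n) - f n)"
  assumes gap: "\<And>n. Suc n < m \<Longrightarrow> g n + \<mu> \<le> g (Suc n)" and \<mu>: "0 < \<mu>"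
    and unit: "\<And>n. n \<in> A \<Longrightarrow> of_int j \<le> g n \<and> g n \<le> of_int j + 1"
    and A: "A \<subseteq> {..<m}"
    and convex: "\<And>x y z. x \<in> A \<Longrightarrow> z \<in> A \<Longrightarrow> x \<le> y \<Longrightarrow> y \<le> z \<Longrightarrow> y \<in> A"
    and \<theta>: "0 < \<theta>"
  shows "norm (\<Sum>n\<in>A. ee (f n)) \<le> 2 * (\<theta> / \<mu> + 1) + 1 / \<theta>"
proof -
  have fin: "finite A" using A finite_subset by blast
  have mono: "g a \<le> g b" if "a \<le> b" "b < m" for a b
    using mono_of_gap[of m g \<mu> a b] gap \<mu> that by auto
  have short: "real (card B) \<le> \<theta> / \<mu> + 1"
    if B: "B \<subseteq> A" "\<And>x y z. x \<in> B \<Longrightarrow> z \<in> B \<Longrightarrow> x \<le> y \<Longrightarrow> y \<le> z \<Longrightarrow> y \<in> B"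
      "\<And>n. n \<in> B \<Longrightarrow> u \<le> g n \<and> g n \<le> u + \<theta>" for B u
  proof -
    obtain a k where ak: "B = {a..<a + k}"
      using convex_nat_set_is_interval[of B] B(1,2) fin finite_subset by metis
    show ?thesis
    proof (cases k)
      case 0
      thus ?thesis using ak \<theta> \<mu> by simp
    next
      case (Suc l)
      have "a \<in> B" "a + l \<in> B" using ak Suc by auto
      moreover from this have "g a + real l * \<mu> \<le> g (a + l)"
        using A B(1) by (intro gap_mono[where m = m] gap) auto
      ultimately have "real l * \<mu> \<le> \<theta>" using B(3)[of a] B(3)[of "a + l"] by linarith
      thus ?thesis using ak Suc \<mu> by (simp add: field_simps)
    qed
  qed
  define P where "P = {n \<in> A. g n < of_int j + \<theta>}"
  define Q where "Q = {n \<in> A - P. g n > of_int j + 1 - \<theta>}"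
  define R where "R = A - P - Q"
  have in_m: "n < m" if "n \<in> A" for n using A that by auto
  have between: "g x \<le> g y \<and> g y \<le> g z" if "z \<in> A" "x \<le> y" "y \<le> z" for x y z
    using mono[of x y] mono[of y z] in_m[OF that(1)] that by auto
  have P: "real (card P) \<le> \<theta> / \<mu> + 1"
  proof (rule short[where u = "of_int j"])
    show "y \<in> P" if "x \<in> P" "z \<in> P" "x \<le> y" "y \<le> z" for x y z
      using that convex[of x z y] between[of z x y] by (auto simp: P_def)
  qed (use unit in \<open>auto simp: P_def intro: less_imp_le\<close>)
  have Q: "real (card Q) \<le> \<theta> / \<mu> + 1"
  proof (rule short[where u = "of_int j + 1 - \<theta>"])
    show "y \<in> Q" if "x \<in> Q" "z \<in> Q" "x \<le> y" "y \<le> z" for x y z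
      using that convex[of x z y] between[of z x y] by (auto simp: P_def Q_def)
  qed (use unit in \<open>auto simp: P_def Q_def intro: less_imp_le\<close>)
  have split: "(\<Sum>n\<in>A. ee (f n)) = (\<Sum>n\<in>P. ee (f n)) + (\<Sum>n\<in>Q. ee (f n)) + (\<Sum>n\<in>R. ee (f n))"
  proof -
    have "(\<Sum>n\<in>A. ee (f n)) = (\<Sum>n\<in>A - P. ee (f n)) + (\<Sum>n\<in>P. ee (f n))"
      using fin by (intro sum.subset_diff) (auto simp: P_def)
    moreover have "(\<Sum>n\<in>A - P. ee (f n)) = (\<Sum>n\<in>R. ee (f n)) + (\<Sum>n\<in>Q. ee (f n))"
      unfolding R_def using fin by (intro sum.subset_diff) (auto simp: Q_def)
    ultimately show ?thesis by simp
  qed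
  have "norm (\<Sum>n\<in>R. ee (f n)) \<le> 1 / \<theta>"
  proof -
    have "y \<in> R" if "x \<in> R" "z \<in> R" "x \<le> y" "y \<le> z" for x y z
      using that convex[of x z y] between[of z x y] by (auto simp: P_def Q_def R_def)
    then obtain a k where ak: "R = {a..<a + k}"
      using convex_nat_set_is_interval[of R] fin by (metis R_def finite_Diff)
    have R: "of_int j + \<theta> \<le> g n \<and> g n \<le> of_int j + 1 - \<theta> \<and> n < m" if "n \<in> R" for n
      using that in_m by (auto simp: P_def Q_def R_def)
    have "(\<Sum>n\<in>R. ee (f n)) = (\<Sum>n<k. ee (f (a + n)))"
      unfolding ak by (rule sum.reindex_bij_witness[of _ "\<lambda>n. a + n" "\<lambda>n. n - a"]) auto
    also have "norm \<dots> \<le> 1 / \<theta>"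
    proof (rule kusmin_landau[OF \<theta>, of _ j])
      fix n assume "n < k"
      thus "of_int j + \<theta> \<le> f (a + Suc n) - f (a + n) \<and> f (a + Suc n) - f (a + n) \<le> of_int j + 1 - \<theta>"
        using R[of "a + n"] ak by (simp add: g_def)
    next
      fix n assume "Suc n < k"
      hence "a + Suc n \<in> R" using ak by auto
      thus "f (a + Suc n) - f (a + n) \<le> f (a + Suc (Suc n)) - f (a + Suc n)"
        using mono[of "a + n" "a + Suc n"] R by (auto simp: g_def)
    qed
    finally show ?thesis .
  qed
  moreover have "norm (\<Sum>n\<in>P. ee (f n)) \<le> \<theta> / \<mu> + 1" "norm (\<Sum>n\<in>Q. ee (f n)) \<le> \<theta> / \<mu> + 1"
    using P Q norm_sum_ee_le[of f P] norm_sum_ee_le[of f Q] by linarith+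
  ultimately have "norm (\<Sum>n\<in>A. ee (f n)) \<le> (\<theta> / \<mu> + 1) + (\<theta> / \<mu> + 1) + 1 / \<theta>"
    unfolding split by (intro norm_triangle_le add_mono)
  thus ?thesis by simp
qed

section \<open>The second difference test\<close>

primrec fdiff :: "nat \<Rightarrow> (nat \<Rightarrow> real) \<Rightarrow> nat \<Rightarrow> real" where
  "fdiff 0 f = f"
| "fdiff (Suc k) f = (\<lambda>n. fdiff k f (Suc n) - fdiff k f n)"

text \<open>
  Van der Corput's \<open>k\<close>-th derivative test with exponents \<open>\<kappa>\<close>, \<open>\<beta>\<close> and constant \<open>C\<close>, for phases whose
  \<open>k\<close>-th differences vary by a factor of at most \<open>\<alpha>\<close>.  Only differences formed inside the range of
  summation are constrained, which makes the test applicable to subintervals and to differenced phases.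
\<close>
definition vdc_bound :: "nat \<Rightarrow> real \<Rightarrow> real \<Rightarrow> real \<Rightarrow> real \<Rightarrow> bool" where
  "vdc_bound k \<alpha> \<kappa> \<beta> C \<longleftrightarrow> (\<forall>f N \<mu>. \<mu> > 0 \<longrightarrow>
     (\<forall>n. n + k < N \<longrightarrow> \<mu> \<le> fdiff k f n \<and> fdiff k f n \<le> \<alpha> * \<mu>) \<longrightarrow>
     norm (\<Sum>n<N. ee (f n)) \<le> C * (real N * \<mu> powr \<kappa> + real N powr \<beta> * \<mu> powr (- \<kappa>)))"

text \<open>
  The increments \<open>f (n + 1) - f n\<close> increase by between \<open>\<mu>\<close> and \<open>\<alpha> * \<mu>\<close> per step, so they cross at most
  \<open>\<alpha> * \<mu> * N + 2\<close> unit intervals.  Each contributes \<open>O(1 + \<theta> / \<mu> + 1 / \<theta>)\<close>, which is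
  balanced by \<open>\<theta> = sqrt \<mu>\<close>.
\<close>
lemma vdc_second_difference:
  assumes \<alpha>: "\<alpha> \<ge> 1"
  shows "vdc_bound 2 \<alpha> (1/2) 0 (20 * \<alpha>)"
  unfolding vdc_bound_def
proof (intro allI impI)
  fix f :: "nat \<Rightarrow> real" and N :: nat and \<mu> :: real
  assume \<mu>: "\<mu> > 0"
  assume "\<forall>n. n + 2 < N \<longrightarrow> \<mu> \<le> fdiff 2 f n \<and> fdiff 2 f n \<le> \<alpha> * \<mu>"
  hence h: "\<mu> \<le> fdiff 2 f n" "fdiff 2 f n \<le> \<alpha> * \<mu>" if "n + 2 < N" for n using that by blast+
  show "norm (\<Sum>n<N. ee (f n)) \<le> 20 * \<alpha> * (real N * \<mu> powr (1/2) + real N powr 0 * \<mu> powr (- (1/2)))"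
  \<comment> \<open>For \<open>\<mu> \<ge> 1\<close> counting the terms suffices.\<close>
  proof (cases "N = 0 \<or> \<mu> \<ge> 1")
    case True
    have "norm (\<Sum>n<N. ee (f n)) \<le> real N * (\<mu> powr (1/2))"
    proof (cases "N = 0")
      case False
      hence "1 \<le> \<mu> powr (1/2)" using True by (intro ge_one_powr_ge_zero) auto
      hence "real N * 1 \<le> real N * \<mu> powr (1/2)" by (intro mult_left_mono) auto
      thus ?thesis using norm_sum_ee_le[of f "{..<N}"] by simp
    qed simp
    also have "\<dots> \<le> 1 * (real N * \<mu> powr (1/2) + real N powr 0 * \<mu> powr (- (1/2)))" by simp
    also have "\<dots> \<le> 20 * \<alpha> * (real N * \<mu> powr (1/2) + real N powr 0 * \<mu> powr (- (1/2)))"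
      using \<alpha> by (intro mult_right_mono) auto
    finally show ?thesis .
  next
    case False
    \<comment> \<open>The last term has no increment inside the range and is estimated by \<open>1\<close> in the end.\<close>
    then obtain m where m: "N = Suc m" by (cases N) auto
    define r where "r = sqrt \<mu>"
    have r: "0 < r" "r < 1" "r * r = \<mu>" using \<mu> False by (auto simp: r_def)
    define g where "g = (\<lambda>n. f (Suc n) - f n)"
    have gap: "g n + \<mu> \<le> g (Suc n)" and gap': "g (Suc n) \<le> g n + \<alpha> * \<mu>" if "Suc n < m" for n
      using h[of n] that m by (simp_all add: g_def numeral_2_eq_2)
    have mono: "g a \<le> g b" if "a \<le> b" "b < m" for a b
      using mono_of_gap[of m g \<mu> a b] gap \<mu> that by auto
    have up: "g n \<le> g 0 + \<alpha> * \<mu> * real n" if "n < m" for n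
      using that
    proof (induction n)
      case (Suc n)
      thus ?case using gap'[of n] by (simp add: algebra_simps)
    qed simp
    define J where "J = (\<lambda>n. \<lfloor>g n\<rfloor>) ` {..<m}"
    have J: "real (card J) \<le> \<alpha> * \<mu> * real N + 2"
    proof -
      have "J \<subseteq> {\<lfloor>g 0\<rfloor>..\<lfloor>g 0 + \<alpha> * \<mu> * real N\<rfloor>}"
      proof
        fix i assume "i \<in> J"
        then obtain n where n: "n < m" "i = \<lfloor>g n\<rfloor>" by (auto simp: J_def)
        have "\<alpha> * \<mu> * real n \<le> \<alpha> * \<mu> * real N" using \<mu> \<alpha> n m by (intro mult_left_mono) auto
        thus "i \<in> {\<lfloor>g 0\<rfloor>..\<lfloor>g 0 + \<alpha> * \<mu> * real N\<rfloor>}"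
          using up[of n] mono[of 0 n] n by (auto intro!: floor_mono)
      qed
      hence "card J \<le> nat (\<lfloor>g 0 + \<alpha> * \<mu> * real N\<rfloor> + 1 - \<lfloor>g 0\<rfloor>)"
        using card_mono[of "{\<lfloor>g 0\<rfloor>..\<lfloor>g 0 + \<alpha> * \<mu> * real N\<rfloor>}" J] by simp
      moreover have "0 \<le> \<alpha> * \<mu> * real N" using \<mu> \<alpha> by simp
      ultimately show ?thesis by linarith
    qed
    have "(\<Sum>n<m. ee (f n)) = (\<Sum>i\<in>J. \<Sum>n\<in>{n \<in> {..<m}. \<lfloor>g n\<rfloor> = i}. ee (f n))"
      unfolding J_def by (rule sum.image_gen) simp
    also have "norm \<dots> \<le> (\<Sum>i\<in>J. 5 / r)"
    proof (rule sum_norm_le)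
      fix i assume "i \<in> J"
      have "norm (\<Sum>n\<in>{n \<in> {..<m}. \<lfloor>g n\<rfloor> = i}. ee (f n)) \<le> 2 * (r / \<mu> + 1) + 1 / r"
      proof (rule slow_window_bound[where j = i and m = m])
        fix x y z assume "x \<in> {n \<in> {..<m}. \<lfloor>g n\<rfloor> = i}" "z \<in> {n \<in> {..<m}. \<lfloor>g n\<rfloor> = i}" "x \<le> y" "y \<le> z"
        moreover from this have "\<lfloor>g x\<rfloor> \<le> \<lfloor>g y\<rfloor>" "\<lfloor>g y\<rfloor> \<le> \<lfloor>g z\<rfloor>"
          using floor_mono[OF mono[of x y]] floor_mono[OF mono[of y z]] by auto
        ultimately show "y \<in> {n \<in> {..<m}. \<lfloor>g n\<rfloor> = i}" by auto
      next
        fix n assume "n \<in> {n \<in> {..<m}. \<lfloor>g n\<rfloor> = i}"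
        hence "\<lfloor>g n\<rfloor> = i" by auto
        thus "of_int i \<le> f (Suc n) - f n \<and> f (Suc n) - f n \<le> of_int i + 1"
          unfolding g_def by linarith
      qed (use gap \<mu> r in \<open>auto simp: g_def\<close>)
      also have "r / \<mu> = 1 / r" using r \<mu> by (simp add: field_simps)
      also have "2 * (1 / r + 1) + 1 / r \<le> 5 / r" using r by (simp add: field_simps)
      finally show "norm (\<Sum>n\<in>{n \<in> {..<m}. \<lfloor>g n\<rfloor> = i}. ee (f n)) \<le> 5 / r" .
    qed
    also have "\<dots> \<le> (\<alpha> * \<mu> * real N + 2) * (5 / r)"
      using J r by (simp add: divide_right_mono)
    finally have "norm (\<Sum>n<m. ee (f n)) \<le> (\<alpha> * \<mu> * real N + 2) * (5 / r)" .
    moreover have "norm (\<Sum>n<N. ee (f n)) \<le> norm (\<Sum>n<m. ee (f n)) + 1"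
      unfolding m using norm_triangle_ineq[of "\<Sum>n<m. ee (f n)" "ee (f m)"] by simp
    moreover have "(\<alpha> * \<mu> * real N + 2) * (5 / r) + 1 \<le> 20 * \<alpha> * (real N * r + 1 / r)"
    proof -
      have "(\<alpha> * \<mu> * real N + 2) * (5 / r) = 5 * (\<alpha> * (real N * r)) + 10 * (1 / r)"
        using r by (simp add: field_simps flip: r(3))
      moreover have "1 \<le> 1 / r" using r by simp
      moreover have "1 / r \<le> \<alpha> / r" using r \<alpha> by (simp add: divide_right_mono)
      moreover have "0 \<le> \<alpha> * (real N * r)" using r \<alpha> by simp
      moreover have "20 * \<alpha> * (real N * r + 1 / r) = 20 * (\<alpha> * (real N * r)) + 20 * (\<alpha> / r)"
        by (simp add: algebra_simps)
      ultimately show ?thesis by linarith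
    qed
    ultimately have "norm (\<Sum>n<N. ee (f n)) \<le> 20 * \<alpha> * (real N * r + 1 / r)" by linarith
    also have "r = \<mu> powr (1/2)" using \<mu> by (simp add: r_def powr_half_sqrt)
    finally show ?thesis using m \<mu> by (simp add: powr_minus_divide)
  qed
qed

section \<open>Weyl differencing\<close>

lemma fdiff_shift_diff:
  "fdiff k (\<lambda>n. f (n + d) - f n) n = (\<Sum>j<d. fdiff (Suc k) f (n + j))"
proof -
  have "fdiff k (\<lambda>n. f (n + d) - f n) n = fdiff k f (n + d) - fdiff k f n" for n
    by (induction k arbitrary: n) simp_all
  also have "fdiff k f (n + d) - fdiff k f n = (\<Sum>j<d. fdiff (Suc k) f (n + j))" for n
    using sum_lessThan_telescope[of "\<lambda>j. fdiff k f (n + j)" d] by simp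
  finally show ?thesis .
qed

lemma sum_pairs_by_difference:
  fixes B :: "nat \<Rightarrow> real"
  assumes "\<And>d. B d \<ge> 0"
  shows "(\<Sum>a<H. \<Sum>b\<in>{a<..<H}. B (b - a)) \<le> real H * (\<Sum>d\<in>{1..<H}. B d)"
proof -
  have "(\<Sum>b\<in>{a<..<H}. B (b - a)) \<le> (\<Sum>d\<in>{1..<H}. B d)" for a
  proof -
    have "(\<Sum>b\<in>{a<..<H}. B (b - a)) = (\<Sum>d\<in>{1..<H - a}. B d)"
      by (rule sum.reindex_bij_witness[of _ "\<lambda>d. d + a" "\<lambda>b. b - a"]) auto
    also have "\<dots> \<le> (\<Sum>d\<in>{1..<H}. B d)" using assms by (intro sum_mono2) auto
    finally show ?thesis .
  qed
  hence "(\<Sum>a<H. \<Sum>b\<in>{a<..<H}. B (b - a)) \<le> (\<Sum>a<H. \<Sum>d\<in>{1..<H}. B d)"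
    by (intro sum_mono)
  thus ?thesis by simp
qed

lemma norm_sum_squared_le_card:
  fixes f :: "'a \<Rightarrow> complex"
  assumes "finite A"
  shows "(norm (\<Sum>x\<in>A. f x))\<^sup>2 \<le> real (card A) * (\<Sum>x\<in>A. (norm (f x))\<^sup>2)"
proof -
  have "(norm (\<Sum>x\<in>A. f x))\<^sup>2 \<le> (\<Sum>x\<in>A. norm (f x))\<^sup>2"
    by (intro power_mono norm_sum) auto
  also have "\<dots> \<le> (\<Sum>x\<in>A. 1\<^sup>2) * (\<Sum>x\<in>A. (norm (f x))\<^sup>2)"
    using Cauchy_Schwarz_ineq_sum[of "\<lambda>_. 1" "\<lambda>x. norm (f x)" A] by simp
  finally show ?thesis by simp
qed

text \<open>
  Averaging over the \<open>H\<close> shifts of the summation range writes \<open>H\<close> times the sum as a sum over \<open>N + H\<close>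
  positions of short sums of length \<open>H\<close>.  Cauchy--Schwarz over the positions and expanding the square
  give the correlations of \<open>z\<close> with its shifts; the diagonal contributes \<open>H * N\<close>, and each distance \<open>d\<close>
  occurs at most \<open>2 * H\<close> times off the diagonal.
\<close>
lemma weyl_van_der_corput:
  fixes z :: "nat \<Rightarrow> complex" and B :: "nat \<Rightarrow> real"
  assumes z: "\<And>n. norm (z n) = 1" and H: "0 < H"
    and B: "\<And>d. 1 \<le> d \<Longrightarrow> d < H \<Longrightarrow> norm (\<Sum>n<N - d. z (n + d) * cnj (z n)) \<le> B d"
    and B0: "\<And>d. B d \<ge> 0"
  shows "(norm (\<Sum>n<N. z n))\<^sup>2 \<le> real (N + H) * (real N / real H + 2 / real H * (\<Sum>d\<in>{1..<H}. B d))"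
proof -
  \<comment> \<open>The entry of \<open>z\<close>, extended by zero outside \<open>{..<N}\<close>, that the \<open>h\<close>-th shift puts at position \<open>m\<close>.\<close>
  define w where "w m h = (if h \<le> m \<and> m < N + h then z (m - h) else 0)" for m h
  define S where "S = (\<Sum>n<N. z n)"
  define c where "c a b = (\<Sum>m<N + H. w m a * cnj (w m b))" for a b
  have row: "(\<Sum>m<N + H. w m h) = S" if "h < H" for h
  proof -
    have "(\<Sum>m<N + H. w m h) = (\<Sum>m\<in>{h..<N + h}. z (m - h))"
      using that unfolding w_def by (intro sum.mono_neutral_cong_right) auto
    also have "\<dots> = S" unfolding S_def
      by (rule sum.reindex_bij_witness[of _ "\<lambda>n. n + h" "\<lambda>m. m - h"]) auto
    finally show ?thesis .
  qed
  have diag: "norm (c a a) \<le> real N" if "a < H" for a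
  proof -
    have "c a a = (\<Sum>m\<in>{a..<N + a}. 1)"
      unfolding c_def w_def using that z
      by (intro sum.mono_neutral_cong_right) (auto simp: complex_norm_square[symmetric])
    thus ?thesis by simp
  qed
  have off: "norm (c a b) \<le> B (b - a)" "norm (c b a) \<le> B (b - a)" if "a < b" "b < H" for a b
  proof -
    have "c a b = (\<Sum>m\<in>{b..<N + a}. z (m - a) * cnj (z (m - b)))"
      unfolding c_def w_def using that by (intro sum.mono_neutral_cong_right) auto
    also have "\<dots> = (\<Sum>n<N - (b - a). z (n + (b - a)) * cnj (z n))"
      using that by (intro sum.reindex_bij_witness[of _ "\<lambda>n. n + b" "\<lambda>m. m - b"]) auto
    finally show "norm (c a b) \<le> B (b - a)" using B[of "b - a"] that by simp
    have "c b a = cnj (c a b)" by (simp add: c_def mult.commute)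
    thus "norm (c b a) \<le> B (b - a)" using \<open>norm (c a b) \<le> B (b - a)\<close> by simp
  qed
  have "(real H)\<^sup>2 * (norm S)\<^sup>2 = (norm (\<Sum>h<H. \<Sum>m<N + H. w m h))\<^sup>2"
    using row by (simp add: norm_mult power_mult_distrib)
  also have "(\<Sum>h<H. \<Sum>m<N + H. w m h) = (\<Sum>m<N + H. \<Sum>h<H. w m h)"
    by (rule sum.swap)
  also have "(norm (\<Sum>m<N + H. \<Sum>h<H. w m h))\<^sup>2 \<le> real (N + H) * (\<Sum>m<N + H. (norm (\<Sum>h<H. w m h))\<^sup>2)"
    using norm_sum_squared_le_card[of "{..<N + H}"] by simp
  also have "(\<Sum>m<N + H. (norm (\<Sum>h<H. w m h))\<^sup>2) \<le> norm (\<Sum>a<H. \<Sum>b<H. c a b)"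
  proof -
    have "complex_of_real (\<Sum>m<N + H. (norm (\<Sum>h<H. w m h))\<^sup>2)
        = (\<Sum>m<N + H. \<Sum>a<H. \<Sum>b<H. w m a * cnj (w m b))"
      by (simp only: of_real_sum complex_norm_square cnj_sum sum_product)
    also have "\<dots> = (\<Sum>a<H. \<Sum>m<N + H. \<Sum>b<H. w m a * cnj (w m b))"
      by (rule sum.swap)
    also have "\<dots> = (\<Sum>a<H. \<Sum>b<H. c a b)"
      unfolding c_def by (intro sum.cong refl sum.swap)
    finally have "(\<Sum>a<H. \<Sum>b<H. c a b) = complex_of_real (\<Sum>m<N + H. (norm (\<Sum>h<H. w m h))\<^sup>2)" ..
    thus ?thesis by (simp only: norm_of_real)
  qed
  also have "norm (\<Sum>a<H. \<Sum>b<H. c a b) \<le> (\<Sum>a<H. \<Sum>b<H. norm (c a b))"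
    by (intro sum_norm_le order_refl)
  also have "(\<Sum>a<H. \<Sum>b<H. norm (c a b)) =
      (\<Sum>a<H. norm (c a a)) + (\<Sum>a<H. \<Sum>b\<in>{a<..<H}. norm (c a b) + norm (c b a))"
  proof -
    have "(\<Sum>b<H. norm (c a b)) = norm (c a a) + (\<Sum>b\<in>{a<..<H}. norm (c a b)) + (\<Sum>b<a. norm (c a b))"
      if "a < H" for a
    proof -
      have "{..<H} = insert a ({a<..<H} \<union> {..<a})" using that by auto
      thus ?thesis by (simp add: sum.union_disjoint add.assoc Int_def)
    qed
    hence "(\<Sum>a<H. \<Sum>b<H. norm (c a b)) = (\<Sum>a<H. norm (c a a)) +
        (\<Sum>a<H. \<Sum>b\<in>{a<..<H}. norm (c a b)) + (\<Sum>a<H. \<Sum>b<a. norm (c a b))"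
      by (simp add: sum.distrib)
    also have "(\<Sum>a<H. \<Sum>b<a. norm (c a b)) = (\<Sum>a<H. \<Sum>b\<in>{a<..<H}. norm (c b a))"
    proof -
      have "(\<Sum>a<H. \<Sum>b<a. norm (c a b)) = (\<Sum>(a,b)\<in>(SIGMA a:{..<H}. {..<a}). norm (c a b))"
        by (rule sum.Sigma) auto
      also have "\<dots> = (\<Sum>(a,b)\<in>(SIGMA a:{..<H}. {a<..<H}). norm (c b a))"
        by (rule sum.reindex_bij_witness[of _ "\<lambda>(a,b). (b,a)" "\<lambda>(a,b). (b,a)"]) auto
      also have "\<dots> = (\<Sum>a<H. \<Sum>b\<in>{a<..<H}. norm (c b a))"
        by (rule sum.Sigma[symmetric]) auto
      finally show ?thesis .
    qed
    finally show ?thesis by (simp add: sum.distrib)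
  qed
  also have "\<dots> \<le> (\<Sum>a<H. real N) + (\<Sum>a<H. \<Sum>b\<in>{a<..<H}. 2 * B (b - a))"
    using off diag by (intro add_mono sum_mono) (smt (verit) greaterThanLessThan_iff lessThan_iff)+
  also have "\<dots> = real H * real N + 2 * (\<Sum>a<H. \<Sum>b\<in>{a<..<H}. B (b - a))"
    by (simp add: sum_distrib_left)
  also have "\<dots> \<le> real H * real N + 2 * (real H * (\<Sum>d\<in>{1..<H}. B d))"
    using sum_pairs_by_difference[of B H] B0 by simp
  finally have "(real H)\<^sup>2 * (norm S)\<^sup>2 \<le> real (N + H) * (real H * real N + 2 * (real H * (\<Sum>d\<in>{1..<H}. B d)))"
    by (simp add: mult_left_mono)
  also have "\<dots> = (real H)\<^sup>2 * (real (N + H) * (real N / real H + 2 / real H * (\<Sum>d\<in>{1..<H}. B d)))"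
    using H by (simp add: field_simps power2_eq_square)
  finally show ?thesis using H unfolding S_def by simp
qed

lemma powr_neg_le_telescope:
  assumes "0 < \<kappa>" "\<kappa> \<le> 1/2"
  shows "real (Suc d) powr (- \<kappa>) \<le> 2 * (real (Suc d) powr (1 - \<kappa>) - real d powr (1 - \<kappa>))"
proof (cases "d = 0")
  case False
  have "\<exists>z. z > real d \<and> z < real (Suc d) \<and>
     real (Suc d) powr (1 - \<kappa>) - real d powr (1 - \<kappa>) = (real (Suc d) - real d) * ((1 - \<kappa>) * z powr (1 - \<kappa> - 1))"
    using False by (intro MVT2) (auto intro!: derivative_eq_intros)
  then obtain z where z: "z > real d" "z < real (Suc d)"
    "real (Suc d) powr (1 - \<kappa>) - real d powr (1 - \<kappa>) = (1 - \<kappa>) * z powr (- \<kappa>)" by auto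
  have "real (Suc d) powr (- \<kappa>) \<le> z powr (- \<kappa>)" using z assms False by (intro powr_mono2') auto
  also have "\<dots> \<le> 2 * ((1 - \<kappa>) * z powr (- \<kappa>))"
    using assms mult_right_mono[of 1 "2 * (1 - \<kappa>)" "z powr (-\<kappa>)"] by (simp add: algebra_simps)
  finally show ?thesis using z(3) by simp
qed auto

lemma sum_powr_neg_le:
  assumes "0 < \<kappa>" "\<kappa> \<le> 1/2" "0 < H"
  shows "(\<Sum>d\<in>{1..<H}. real d powr (- \<kappa>)) \<le> 2 * real H powr (1 - \<kappa>)"
proof -
  have "(\<Sum>d\<in>{1..<H}. real d powr (- \<kappa>)) = (\<Sum>d<H - 1. real (Suc d) powr (- \<kappa>))"
    by (rule sum.reindex_bij_witness[of _ Suc "\<lambda>d. d - 1"]) auto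
  also have "\<dots> \<le> (\<Sum>d<H - 1. 2 * (real (Suc d) powr (1 - \<kappa>) - real d powr (1 - \<kappa>)))"
    by (intro sum_mono powr_neg_le_telescope assms)
  also have "\<dots> = 2 * (\<Sum>d<H - 1. real (Suc d) powr (1 - \<kappa>) - real d powr (1 - \<kappa>))"
    by (rule sum_distrib_left[symmetric])
  also have "\<dots> = 2 * (real (H - 1) powr (1 - \<kappa>))"
    using assms by (subst sum_lessThan_telescope) simp
  also have "\<dots> \<le> 2 * real H powr (1 - \<kappa>)" using assms by (intro mult_left_mono powr_mono2) auto
  finally show ?thesis .
qed

text \<open>
  Differencing with shifts up to \<open>H\<close> and the bound for \<open>k\<close>-th differences of size \<open>d * \<mu>\<close> give for the square
  of the sum a bound of order
  \<open>N * (N / H + N * (H * \<mu>) powr \<kappa> + N powr \<beta> * (H * \<mu>) powr (-\<kappa>))\<close>.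
  The first two terms balance for \<open>H = \<mu> powr (-\<kappa> / (1 + \<kappa>))\<close>, and both are then \<open>N\<^sup>2 * \<mu> powr (\<kappa> / (1 + \<kappa>))\<close>.
  Summing \<open>d powr (-\<kappa>)\<close> over the shifts costs a factor \<open>2\<close> because \<open>\<kappa> \<le> 1/2\<close>.
\<close>
lemma vdc_bound_step:
  assumes vdc: "vdc_bound k \<alpha> \<kappa> \<beta> C"
    and \<kappa>: "0 < \<kappa>" "\<kappa> \<le> 1/2" and \<beta>: "0 \<le> \<beta>" and C: "0 \<le> C"
  shows "vdc_bound (Suc k) \<alpha> (\<kappa> / (2 * (1 + \<kappa>))) ((1 + \<beta>) / 2) (4 * (1 + C))"
  unfolding vdc_bound_def
proof (intro allI impI)
  fix f :: "nat \<Rightarrow> real" and N :: nat and \<mu> :: real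
  assume \<mu>: "\<mu> > 0"
  assume "\<forall>n. n + Suc k < N \<longrightarrow> \<mu> \<le> fdiff (Suc k) f n \<and> fdiff (Suc k) f n \<le> \<alpha> * \<mu>"
  hence h: "\<mu> \<le> fdiff (Suc k) f n" "fdiff (Suc k) f n \<le> \<alpha> * \<mu>" if "n + Suc k < N" for n
    using that by blast+
  define \<kappa>' where "\<kappa>' = \<kappa> / (2 * (1 + \<kappa>))"
  define \<beta>' where "\<beta>' = (1 + \<beta>) / 2"
  have \<kappa>': "0 < \<kappa>'" using \<kappa> by (simp add: \<kappa>'_def)
  define X where "X = \<mu> powr (- 2 * \<kappa>')"
  define rhs where "rhs = real N * \<mu> powr \<kappa>' + real N powr \<beta>' * \<mu> powr (- \<kappa>')"
  have rhs0: "0 \<le> rhs" by (simp add: rhs_def)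
  \<comment> \<open>If \<open>\<mu> \<ge> 1\<close>, or if the optimal number \<open>X\<close> of shifts exceeds \<open>N\<close>, counting the terms suffices.\<close>
  have "norm (\<Sum>n<N. ee (f n)) \<le> 4 * (1 + C) * rhs"
  proof (cases "N = 0 \<or> \<mu> \<ge> 1 \<or> X > real N")
    case True
    have "real N \<le> rhs"
    proof -
      consider "N = 0" | "N > 0" "\<mu> \<ge> 1" | "N > 0" "X > real N" using True by blast
      thus ?thesis
      proof cases
        case 2
        hence "1 \<le> \<mu> powr \<kappa>'" using \<kappa>' by (intro ge_one_powr_ge_zero) auto
        hence "real N * 1 \<le> real N * \<mu> powr \<kappa>'" by (intro mult_left_mono) auto
        thus ?thesis by (simp add: rhs_def add_increasing2)
      next
        case 3
        have "real N powr (1/2) \<le> X powr (1/2)" using 3 by (intro powr_mono2) auto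
        also have "\<dots> = \<mu> powr (- \<kappa>')" by (simp add: X_def powr_powr)
        finally have "real N powr (1/2) * real N powr (1/2) \<le> real N powr \<beta>' * \<mu> powr (- \<kappa>')"
          using 3 \<beta> by (intro mult_mono powr_mono) (auto simp: \<beta>'_def)
        hence "real N \<le> real N powr \<beta>' * \<mu> powr (- \<kappa>')" using 3 by (simp flip: powr_add)
        thus ?thesis by (simp add: rhs_def add_increasing)
      qed (simp add: rhs0)
    qed
    moreover have "rhs \<le> 4 * (1 + C) * rhs"
      using C rhs0 mult_right_mono[of 1 "4 * (1 + C)" rhs] by simp
    ultimately show ?thesis using norm_sum_ee_le[of f "{..<N}"] by simp
  next
    case False
    hence N: "N > 0" and \<mu>1: "\<mu> < 1" and XN: "X \<le> real N" by auto
    have X1: "1 \<le> X" using \<mu> \<mu>1 \<kappa>' by (simp add: X_def powr_le_one_le ge_one_powr_ge_zero powr_minus_divide powr_le1)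
    define H where "H = nat \<lfloor>X\<rfloor>"
    have H: "0 < H" "real H \<le> X" "X \<le> 2 * real H"
    proof -
      have "1 \<le> \<lfloor>X\<rfloor>" using X1 by simp
      hence "real H = of_int \<lfloor>X\<rfloor>" "1 \<le> real H" by (simp_all add: H_def)
      thus "0 < H" "real H \<le> X" "X \<le> 2 * real H" by linarith+
    qed
    have HN: "H \<le> N" using H(2) XN by simp
    define b1 where "b1 = real N * (real H * \<mu>) powr \<kappa>"
    define b2 where "b2 = real N powr \<beta> * \<mu> powr (- \<kappa>)"
    have S: "(norm (\<Sum>n<N. ee (f n)))\<^sup>2 \<le> real (N + H) * (real N / real H
         + 2 / real H * (\<Sum>d\<in>{1..<H}. C * (b1 + b2 * real d powr (- \<kappa>))))"
    proof (rule weyl_van_der_corput)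
      fix d assume d: "1 \<le> d" "d < H"
      have "norm (\<Sum>n<N - d. ee (f (n + d)) * cnj (ee (f n))) = norm (\<Sum>n<N - d. ee (f (n + d) - f n))"
        by (simp add: ee_diff)
      also have "\<dots> \<le> C * (real (N - d) * (real d * \<mu>) powr \<kappa> + real (N - d) powr \<beta> * (real d * \<mu>) powr (- \<kappa>))"
      proof (rule vdc[unfolded vdc_bound_def, rule_format])
        fix n assume n: "n + k < N - d"
        have "(\<Sum>j<d. \<mu>) \<le> (\<Sum>j<d. fdiff (Suc k) f (n + j))"
          using n by (intro sum_mono h) auto
        moreover have "(\<Sum>j<d. fdiff (Suc k) f (n + j)) \<le> (\<Sum>j<d. \<alpha> * \<mu>)"
          using n by (intro sum_mono h) auto
        ultimately show "real d * \<mu> \<le> fdiff k (\<lambda>n. f (n + d) - f n) n \<and>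
            fdiff k (\<lambda>n. f (n + d) - f n) n \<le> \<alpha> * (real d * \<mu>)"
          unfolding fdiff_shift_diff by (simp add: mult_ac)
      qed (use \<mu> d in auto)
      also have "\<dots> \<le> C * (b1 + b2 * real d powr (- \<kappa>))"
      proof (intro mult_left_mono add_mono C)
        show "real (N - d) * (real d * \<mu>) powr \<kappa> \<le> b1"
          unfolding b1_def using d \<mu> \<kappa> by (intro mult_mono powr_mono2) auto
        have "real (N - d) powr \<beta> * (real d * \<mu>) powr (- \<kappa>) \<le> real N powr \<beta> * (real d * \<mu>) powr (- \<kappa>)"
          using d \<beta> by (intro mult_right_mono powr_mono2) auto
        thus "real (N - d) powr \<beta> * (real d * \<mu>) powr (- \<kappa>) \<le> b2 * real d powr (- \<kappa>)"
          using d \<mu> by (simp add: b2_def powr_mult mult_ac)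
      qed
      finally show "norm (\<Sum>n<N - d. ee (f (n + d)) * cnj (ee (f n))) \<le> C * (b1 + b2 * real d powr (- \<kappa>))" .
    qed (use C \<mu> H in \<open>auto simp: b1_def b2_def\<close>)
    have b0: "0 \<le> b1" "0 \<le> b2" by (auto simp: b1_def b2_def)
    have "(\<Sum>d\<in>{1..<H}. C * (b1 + b2 * real d powr (- \<kappa>)))
        = C * (real (H - 1) * b1 + b2 * (\<Sum>d\<in>{1..<H}. real d powr (- \<kappa>)))"
      by (simp add: sum_distrib_left[symmetric] sum.distrib)
    also have "\<dots> \<le> C * (real H * b1 + b2 * (2 * real H powr (1 - \<kappa>)))"
      using b0 H by (intro mult_left_mono add_mono mult_right_mono sum_powr_neg_le \<kappa> C) auto
    also have "real H powr (1 - \<kappa>) = real H * real H powr (- \<kappa>)"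
      using H by (simp add: powr_diff powr_minus_divide)
    finally have "2 / real H * (\<Sum>d\<in>{1..<H}. C * (b1 + b2 * real d powr (- \<kappa>)))
        \<le> 2 / real H * (C * (real H * b1 + b2 * (2 * (real H * real H powr (- \<kappa>)))))"
      using H by (intro mult_left_mono) auto
    also have "\<dots> = 2 * C * b1 + 4 * C * (b2 * real H powr (- \<kappa>))"
      using H by (simp add: field_simps)
    finally have sum_le: "2 / real H * (\<Sum>d\<in>{1..<H}. C * (b1 + b2 * real d powr (- \<kappa>)))
        \<le> 2 * C * b1 + 4 * C * (b2 * real H powr (- \<kappa>))" .
    have XM: "(X * \<mu>) powr \<kappa> = \<mu> powr (2 * \<kappa>')" "(X * \<mu>) powr (- \<kappa>) = \<mu> powr (- 2 * \<kappa>')"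
    proof -
      have "X * \<mu> = \<mu> powr (1 - 2 * \<kappa>')" using \<mu> by (simp add: X_def powr_diff powr_minus_divide)
      moreover have "(1 - 2 * \<kappa>') * \<kappa> = 2 * \<kappa>'" using \<kappa> by (simp add: \<kappa>'_def field_simps)
      ultimately show "(X * \<mu>) powr \<kappa> = \<mu> powr (2 * \<kappa>')" "(X * \<mu>) powr (- \<kappa>) = \<mu> powr (- 2 * \<kappa>')"
        by (simp_all add: powr_powr)
    qed
    have "real N / real H \<le> 2 * (real N / X)"
      using H X1 N by (simp add: field_simps)
    also have "real N / X = real N * \<mu> powr (2 * \<kappa>')" by (simp add: X_def powr_minus_divide)
    finally have e0: "real N / real H \<le> 2 * (real N * \<mu> powr (2 * \<kappa>'))" .
    have e1: "b1 \<le> real N * \<mu> powr (2 * \<kappa>')"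
      unfolding b1_def XM(1)[symmetric] using H \<mu> \<kappa> by (intro mult_left_mono powr_mono2 mult_right_mono) auto
    have e2: "b2 * real H powr (- \<kappa>) \<le> 2 * (real N powr \<beta> * \<mu> powr (- 2 * \<kappa>'))"
    proof -
      have "real H powr (- \<kappa>) \<le> (X / 2) powr (- \<kappa>)"
        using H X1 \<kappa> by (intro powr_mono2') auto
      also have "\<dots> = 2 powr \<kappa> * X powr (- \<kappa>)"
        using X1 by (simp add: powr_divide powr_minus_divide)
      also have "\<dots> \<le> 2 powr 1 * X powr (- \<kappa>)" using \<kappa> by (intro mult_right_mono powr_mono) auto
      finally have "b2 * real H powr (- \<kappa>) \<le> b2 * (2 * X powr (- \<kappa>))"
        using b0 by (intro mult_left_mono) auto
      also have "\<dots> = 2 * (real N powr \<beta> * (X * \<mu>) powr (- \<kappa>))"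
        using X1 \<mu> by (simp add: b2_def powr_mult)
      finally show ?thesis unfolding XM(2) .
    qed
    define u v where "u = real N * \<mu> powr \<kappa>'" and "v = real N powr \<beta>' * \<mu> powr (- \<kappa>')"
    have uv: "0 \<le> u" "0 \<le> v" "rhs = u + v" by (auto simp: u_def v_def rhs_def)
    have u2: "u\<^sup>2 = real N * (real N * \<mu> powr (2 * \<kappa>'))"
      by (simp add: u_def power2_eq_square algebra_simps flip: powr_add)
    have v2: "v\<^sup>2 = real N * (real N powr \<beta> * \<mu> powr (- 2 * \<kappa>'))"
    proof -
      have "v\<^sup>2 = real N powr (2 * \<beta>') * \<mu> powr (- 2 * \<kappa>')"
        by (simp add: v_def power2_eq_square algebra_simps flip: powr_add)
      also have "2 * \<beta>' = 1 + \<beta>" by (simp add: \<beta>'_def)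
      finally show ?thesis using N by (simp add: powr_add)
    qed
    have "real N / real H + 2 / real H * (\<Sum>d\<in>{1..<H}. C * (b1 + b2 * real d powr (- \<kappa>)))
        \<le> real N / real H + (2 * C * b1 + 4 * C * (b2 * real H powr (- \<kappa>)))"
      using sum_le by simp
    also have "\<dots> \<le> 2 * (real N * \<mu> powr (2 * \<kappa>')) + (2 * C * (real N * \<mu> powr (2 * \<kappa>'))
        + 4 * C * (2 * (real N powr \<beta> * \<mu> powr (- 2 * \<kappa>'))))"
      using C by (intro add_mono mult_left_mono e0 e1 e2) auto
    finally have bracket: "real N / real H + 2 / real H * (\<Sum>d\<in>{1..<H}. C * (b1 + b2 * real d powr (- \<kappa>)))
       \<le> 2 * (1 + C) * (real N * \<mu> powr (2 * \<kappa>')) + 8 * C * (real N powr \<beta> * \<mu> powr (- 2 * \<kappa>'))"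
      by (simp add: algebra_simps)
    have "(norm (\<Sum>n<N. ee (f n)))\<^sup>2 \<le> (2 * real N) * (2 * (1 + C) * (real N * \<mu> powr (2 * \<kappa>'))
        + 8 * C * (real N powr \<beta> * \<mu> powr (- 2 * \<kappa>')))"
    proof (rule order_trans[OF S], rule mult_mono[OF _ bracket])
      show "0 \<le> real N / real H + 2 / real H * (\<Sum>d\<in>{1..<H}. C * (b1 + b2 * real d powr (- \<kappa>)))"
        using b0 C by (intro add_nonneg_nonneg mult_nonneg_nonneg sum_nonneg) auto
    qed (use HN in auto)
    also have "\<dots> = 4 * (1 + C) * u\<^sup>2 + 16 * C * v\<^sup>2"
      unfolding u2 v2 by (simp add: algebra_simps)
    also have "\<dots> \<le> (4 * (1 + C))\<^sup>2 * u\<^sup>2 + (4 * (1 + C))\<^sup>2 * v\<^sup>2"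
      using C by (intro add_mono mult_right_mono) (auto simp: power2_eq_square algebra_simps)
    also have "\<dots> \<le> (4 * (1 + C))\<^sup>2 * (u + v)\<^sup>2"
      unfolding distrib_left[symmetric] using uv C by (intro mult_left_mono) (auto simp: power2_sum)
    finally have "(norm (\<Sum>n<N. ee (f n)))\<^sup>2 \<le> (4 * (1 + C) * rhs)\<^sup>2"
      using uv by (simp add: power_mult_distrib)
    thus ?thesis by (rule power2_le_imp_le) (use C rhs0 in auto)
  qed
  thus "norm (\<Sum>n<N. ee (f n)) \<le> 4 * (1 + C) * (real N * \<mu> powr (\<kappa> / (2 * (1 + \<kappa>)))
      + real N powr ((1 + \<beta>) / 2) * \<mu> powr (- (\<kappa> / (2 * (1 + \<kappa>)))))"
    by (simp add: rhs_def \<kappa>'_def \<beta>'_def)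
qed

section \<open>The phase of the zeta function\<close>

text \<open>
  By induction on \<open>k\<close>: the \<open>(k + 1)\<close>-st difference of \<open>D 0\<close> is the \<open>k\<close>-th difference of \<open>D 0 (x + 1) - D 0 x\<close>, and by
  the mean value theorem the \<open>k\<close>-th derivative of the latter is a value of \<open>D (k + 1)\<close>.
\<close>
lemma fdiff_between_derivative_bounds:
  fixes D :: "nat \<Rightarrow> real \<Rightarrow> real"
  assumes "\<And>j x. j < k \<Longrightarrow> a \<le> x \<Longrightarrow> x \<le> b \<Longrightarrow> (D j has_real_derivative D (Suc j) x) (at x)"
    and "\<And>x. a \<le> x \<Longrightarrow> x \<le> b \<Longrightarrow> l \<le> D k x \<and> D k x \<le> u"
    and "a \<le> x0 + real n" "x0 + real (n + k) \<le> b"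
  shows "l \<le> fdiff k (\<lambda>n. D 0 (x0 + real n)) n \<and> fdiff k (\<lambda>n. D 0 (x0 + real n)) n \<le> u"
  using assms
proof (induction k arbitrary: D b)
  case 0
  thus ?case by simp
next
  case (Suc k)
  define G where "G j x = D j (x + 1) - D j x" for j x
  have "l \<le> fdiff k (\<lambda>n. G 0 (x0 + real n)) n \<and> fdiff k (\<lambda>n. G 0 (x0 + real n)) n \<le> u"
  proof (rule Suc.IH)
    fix j x assume jx: "j < k" "a \<le> x" "x \<le> b - 1"
    have "((\<lambda>x. D j (x + 1)) has_real_derivative D (Suc j) (x + 1)) (at x)"
      unfolding DERIV_shift[symmetric] using Suc.prems(1)[of j "x + 1"] jx by auto
    thus "(G j has_real_derivative G (Suc j) x) (at x)"
      unfolding G_def using Suc.prems(1)[of j x] jx by (intro derivative_intros) auto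
  next
    fix x assume x: "a \<le> x" "x \<le> b - 1"
    have "\<exists>z. z > x \<and> z < x + 1 \<and> D k (x + 1) - D k x = (x + 1 - x) * D (Suc k) z"
      using x by (intro MVT2 Suc.prems(1)) auto
    then obtain z where "z > x" "z < x + 1" "G k x = D (Suc k) z" by (auto simp: G_def)
    thus "l \<le> G k x \<and> G k x \<le> u" using Suc.prems(2)[of z] x by auto
  qed (use Suc.prems in auto)
  also have "fdiff k (\<lambda>n. G 0 (x0 + real n)) n = fdiff (Suc k) (\<lambda>n. D 0 (x0 + real n)) n"
    using fdiff_shift_diff[of k "\<lambda>n. D 0 (x0 + real n)" 1 n] by (simp add: G_def add_ac)
  finally show ?case .
qed

text \<open>The sign \<open>(-1) ^ (k - 1)\<close> makes the \<open>k\<close>-th derivative of the logarithm positive.\<close>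
lemma fdiff_ln_bounds:
  assumes s: "0 < s" and k: "1 \<le> k" and M: "1 \<le> M" and n: "n + k \<le> M"
  defines "F \<equiv> (\<lambda>n. (-1) ^ (k - 1) * s * ln (real M + real n))"
  shows "s * fact (k - 1) / (2 * real M) ^ k \<le> fdiff k F n \<and> fdiff k F n \<le> s * fact (k - 1) / real M ^ k"
proof -
  define D where "D j x = (-1) ^ (k - 1) * s * (if j = 0 then ln x else (-1) ^ (j - 1) * fact (j - 1) * inverse x ^ j)"
    for j and x :: real
  have "s * fact (k - 1) / (2 * real M) ^ k \<le> fdiff k (\<lambda>n. D 0 (real M + real n)) n \<and>
      fdiff k (\<lambda>n. D 0 (real M + real n)) n \<le> s * fact (k - 1) / real M ^ k"
  proof (rule fdiff_between_derivative_bounds[where a = "real M" and b = "2 * real M"])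
    fix j x assume x: "real M \<le> x" "x \<le> 2 * real M"
    hence x0: "0 < x" using M by simp
    show "(D j has_real_derivative D (Suc j) x) (at x)"
    proof (cases j)
      case 0
      thus ?thesis unfolding D_def using x0
        by (auto intro!: derivative_eq_intros simp: divide_simps)
    next
      case (Suc i)
      have "((\<lambda>x. inverse x ^ Suc i) has_real_derivative - real (Suc i) * inverse x ^ Suc (Suc i)) (at x)"
        using DERIV_power[OF DERIV_inverse[of x UNIV], of "Suc i"] x0 by (simp add: algebra_simps)
      from DERIV_cmult[OF this, of "(-1) ^ (k - 1) * s * ((-1) ^ i * fact i)"]
      moreover have "D j = (\<lambda>x. (-1) ^ (k - 1) * s * ((-1) ^ i * fact i) * inverse x ^ Suc i)"
        by (simp add: D_def Suc fun_eq_iff mult_ac)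
      moreover have "D (Suc j) x = (-1) ^ (k - 1) * s * ((-1) ^ i * fact i) * (- real (Suc i) * inverse x ^ Suc (Suc i))"
        by (simp add: D_def Suc algebra_simps)
      ultimately show ?thesis by simp
    qed
  next
    fix x assume x: "real M \<le> x" "x \<le> 2 * real M"
    have "D k x = s * fact (k - 1) / x ^ k"
      using k by (simp add: D_def power_inverse divide_inverse flip: power_mult_distrib)
    moreover have "s * fact (k - 1) / (2 * real M) ^ k \<le> s * fact (k - 1) / x ^ k"
      using x s M by (intro divide_left_mono power_mono mult_pos_pos zero_less_power) auto
    moreover have "s * fact (k - 1) / x ^ k \<le> s * fact (k - 1) / real M ^ k"
      using x s M by (intro divide_left_mono power_mono mult_pos_pos zero_less_power) auto
    ultimately show "s * fact (k - 1) / (2 * real M) ^ k \<le> D k x \<and> D k x \<le> s * fact (k - 1) / real M ^ k"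
      by simp
  qed (use n in auto)
  thus ?thesis by (simp add: D_def F_def)
qed

text \<open>
  Over \<open>M, \<dots>, 2 * M\<close> the \<open>k\<close>-th derivative of the phase is of order \<open>t / M ^ k\<close> and varies by a factor
  \<open>2 ^ k\<close>.  If the differences of the phase are negative, the sum is replaced by its conjugate.
\<close>
lemma zeta_phase_sum_bound:
  assumes vdc: "vdc_bound k (2 ^ k) \<kappa> \<beta> C" and k: "1 \<le> k" and C: "0 \<le> C" and \<beta>: "0 \<le> \<beta>"
  obtains C' where "0 \<le> C'"
    "\<And>t M m. 0 < t \<Longrightarrow> 1 \<le> M \<Longrightarrow> m \<le> M \<Longrightarrow>
       norm (\<Sum>n<m. ee (t / (2 * pi) * ln (real (M + n))))
         \<le> C' * (real M powr (1 - real k * \<kappa>) * t powr \<kappa> + real M powr (\<beta> + real k * \<kappa>) * t powr (- \<kappa>))"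
proof
  define c where "c = fact (k - 1) / (2 * pi * 2 ^ k)"
  have c: "0 < c" by (simp add: c_def)
  define C' where "C' = C * (c powr \<kappa> + c powr (- \<kappa>))"
  show "0 \<le> C'" using C by (simp add: C'_def)
  fix t :: real and M m :: nat
  assume t: "0 < t" and M: "1 \<le> M" and m: "m \<le> M"
  define \<mu> where "\<mu> = t / (2 * pi) * fact (k - 1) / (2 * real M) ^ k"
  have \<mu>: "0 < \<mu>" using t M by (simp add: \<mu>_def)
  define F where "F = (\<lambda>n. (-1) ^ (k - 1) * (t / (2 * pi)) * ln (real M + real n))"
  have "norm (\<Sum>n<m. ee (t / (2 * pi) * ln (real (M + n)))) = norm (\<Sum>n<m. ee (F n))"
  proof (cases "even (k - 1)")
    case True
    thus ?thesis by (simp add: F_def)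
  next
    case False
    thus ?thesis using norm_sum_ee_uminus[of "\<lambda>n. t / (2 * pi) * ln (real M + real n)" "{..<m}"] by (simp add: F_def)
  qed
  also have "\<dots> \<le> C * (real m * \<mu> powr \<kappa> + real m powr \<beta> * \<mu> powr (- \<kappa>))"
  proof (rule vdc[unfolded vdc_bound_def, rule_format, OF \<mu>])
    fix n assume "n + k < m"
    moreover have "t / (2 * pi) * fact (k - 1) / real M ^ k = 2 ^ k * \<mu>"
      by (simp add: \<mu>_def power_mult_distrib)
    ultimately show "\<mu> \<le> fdiff k F n \<and> fdiff k F n \<le> 2 ^ k * \<mu>"
      using fdiff_ln_bounds[of "t / (2 * pi)" k M n] t k M m unfolding F_def \<mu>_def by simp
  qed
  also have "\<dots> \<le> C * (real M * \<mu> powr \<kappa> + real M powr \<beta> * \<mu> powr (- \<kappa>))"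
    using m \<beta> C by (intro mult_left_mono add_mono mult_right_mono powr_mono2) auto
  also have "\<dots> = C * (c powr \<kappa> * (real M powr (1 - real k * \<kappa>) * t powr \<kappa>)
      + c powr (- \<kappa>) * (real M powr (\<beta> + real k * \<kappa>) * t powr (- \<kappa>)))"
  proof -
    have "\<mu> = c * (t * real M powr (- real k))"
      using M by (simp add: \<mu>_def c_def powr_minus powr_realpow field_simps)
    hence \<mu>_powr: "\<mu> powr x = c powr x * (t powr x * real M powr (- real k * x))" for x
      using t c M by (simp add: powr_mult powr_powr)
    have 1: "real M * \<mu> powr \<kappa> = c powr \<kappa> * (real M powr (1 - real k * \<kappa>) * t powr \<kappa>)"
      unfolding \<mu>_powr using M by (simp add: powr_diff powr_minus_divide)
    have 2: "real M powr \<beta> * \<mu> powr (- \<kappa>)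
        = c powr (- \<kappa>) * (real M powr (\<beta> + real k * \<kappa>) * t powr (- \<kappa>))"
      unfolding \<mu>_powr by (simp add: powr_add)
    show ?thesis unfolding 1 2 ..
  qed
  also have "\<dots> \<le> C * ((c powr \<kappa> + c powr (- \<kappa>)) * (real M powr (1 - real k * \<kappa>) * t powr \<kappa>)
      + (c powr \<kappa> + c powr (- \<kappa>)) * (real M powr (\<beta> + real k * \<kappa>) * t powr (- \<kappa>)))"
    using C by (intro mult_left_mono add_mono mult_right_mono) auto
  finally show "norm (\<Sum>n<m. ee (t / (2 * pi) * ln (real (M + n))))
         \<le> C' * (real M powr (1 - real k * \<kappa>) * t powr \<kappa> + real M powr (\<beta> + real k * \<kappa>) * t powr (- \<kappa>))"
    by (simp add: C'_def algebra_simps)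
qed

lemma abel_inequality:
  fixes a :: "nat \<Rightarrow> real" and z :: "nat \<Rightarrow> complex"
  assumes dec: "\<And>n. a (Suc n) \<le> a n" and nonneg: "\<And>n. 0 \<le> a n"
    and B: "\<And>m. m \<le> M \<Longrightarrow> norm (\<Sum>n<m. z n) \<le> B"
  shows "norm (\<Sum>n<M. of_real (a n) * z n) \<le> a 0 * B"
proof (cases M)
  case 0
  thus ?thesis using nonneg[of 0] B[of 0] by simp
next
  case (Suc k)
  have "(\<Sum>n<Suc m. of_real (a n) * z n) = of_real (a m) * (\<Sum>n<Suc m. z n)
      + (\<Sum>n<m. of_real (a n - a (Suc n)) * (\<Sum>i<Suc n. z i))" for m
    by (induction m) (simp_all add: algebra_simps)
  hence "norm (\<Sum>n<M. of_real (a n) * z n) \<le> norm (of_real (a k) * (\<Sum>n<Suc k. z n))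
      + norm (\<Sum>n<k. of_real (a n - a (Suc n)) * (\<Sum>i<Suc n. z i))"
    unfolding Suc by (simp only: norm_triangle_ineq)
  also have "\<dots> \<le> a k * B + (\<Sum>n<k. (a n - a (Suc n)) * B)"
  proof (intro add_mono sum_norm_le)
    show "norm (of_real (a k) * (\<Sum>n<Suc k. z n)) \<le> a k * B"
      using nonneg[of k] B[of "Suc k"] Suc unfolding norm_mult by (intro mult_mono) auto
    fix n assume "n \<in> {..<k}"
    thus "norm (of_real (a n - a (Suc n)) * (\<Sum>i<Suc n. z i)) \<le> (a n - a (Suc n)) * B"
      using dec[of n] B[of "Suc n"] Suc unfolding norm_mult norm_of_real by (intro mult_mono) auto
  qed
  also have "\<dots> = a 0 * B"
    unfolding sum_distrib_right[symmetric] sum_lessThan_telescope' by (simp add: algebra_simps)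
  finally show ?thesis .
qed

lemma of_nat_powr_eq_ee:
  assumes "0 < n"
  shows "of_nat n powr (- s) = of_real (real n powr (- Re s)) * ee (- (Im s / (2 * pi) * ln (real n)))"
proof -
  have "of_nat n powr (- s) = exp (- s * of_real (ln (real n)))"
    using assms by (simp add: powr_def Ln_of_nat)
  also have "- s * of_real (ln (real n)) = of_real (- Re s * ln (real n)) + \<i> * of_real (- Im s * ln (real n))"
    by (simp add: complex_eq_iff)
  also have "exp \<dots> = of_real (exp (- Re s * ln (real n))) * cis (- Im s * ln (real n))"
    by (simp only: exp_add exp_of_real cis_conv_exp)
  also have "exp (- Re s * ln (real n)) = real n powr (- Re s)"
    using assms by (simp add: powr_def)
  finally show ?thesis by (simp add: ee_def)
qed

text \<open>
  Conjugation allows the phase to be taken with \<open>\<bar>Im s\<bar>\<close>, so that both half-planes are covered by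
  estimates for positive frequencies.
\<close>
lemma norm_block_le:
  assumes B: "\<And>m. m \<le> M \<Longrightarrow> norm (\<Sum>n<m. ee (\<bar>Im s\<bar> / (2 * pi) * ln (real (M + n)))) \<le> B"
    and M: "1 \<le> M" and s: "0 \<le> Re s"
  shows "norm (\<Sum>n<M. of_nat (M + n) powr (- s)) \<le> real M powr (- Re s) * B"
proof -
  have "(\<Sum>n<M. of_nat (M + n) powr (- s)) = (\<Sum>n<M. of_real (real (M + n) powr (- Re s)) * ee (- (Im s / (2 * pi) * ln (real (M + n)))))"
    using M by (intro sum.cong of_nat_powr_eq_ee refl) auto
  also have "norm \<dots> \<le> real (M + 0) powr (- Re s) * B"
  proof (rule abel_inequality)
    show "real (M + Suc n) powr (- Re s) \<le> real (M + n) powr (- Re s)" for n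
      using M s by (intro powr_mono2') auto
    show "norm (\<Sum>n<m. ee (- (Im s / (2 * pi) * ln (real (M + n))))) \<le> B" if "m \<le> M" for m
    proof (cases "Im s \<ge> 0")
      case True
      thus ?thesis using B[OF that] norm_sum_ee_uminus[of "\<lambda>n. Im s / (2 * pi) * ln (real (M + n))" "{..<m}"] by simp
    next
      case False
      thus ?thesis using B[OF that] by simp
    qed
  qed auto
  finally show ?thesis by simp
qed

section \<open>Approximation of zeta by a Dirichlet polynomial\<close>

lemma holomorphic_zeta: "zeta holomorphic_on UNIV - {1}"
  using zeta_is_zeta by (simp add: is_zeta_def)

text \<open>
  Both sides are holomorphic on the punctured half-plane \<open>Re s > 0\<close> and agree where the Dirichlet series
  converges.
\<close>
lemma zeta_eq_rem_series:
  assumes "0 < Re s" "s \<noteq> 1"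
  shows "(s - 1) * zeta s = 1 + rem_series 1 s"
proof (rule analytic_continuation_open[of "{s. Re s > 1}" "{s. Re s > 0} - {1}" "\<lambda>s. (s - 1) * zeta s" "\<lambda>s. 1 + rem_series 1 s"])
  show "open {s. Re s > 1}" by (rule open_halfspace_Re_gt)
  show "open ({s. Re s > 0} - {1})" by (intro open_Diff open_halfspace_Re_gt) auto
  show "{s. Re s > 1} \<noteq> {}" by (rule halfplane_nonempty)
  show "connected ({s. Re s > 0} - {1})"
    by (intro connected_open_delete convex_connected convex_halfspace_Re_gt open_halfspace_Re_gt) simp
  show "(\<lambda>s. (s - 1) * zeta s) holomorphic_on {s. Re s > 0} - {1}"
    by (intro holomorphic_intros holomorphic_on_subset[OF holomorphic_zeta]) auto
  show "(\<lambda>s. 1 + rem_series 1 s) holomorphic_on {s. Re s > 0} - {1}"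
    by (intro holomorphic_intros holomorphic_on_subset[OF rem_series_holomorphic[of 1]]) auto
  fix z assume "z \<in> {s. Re s > 1}"
  thus "(z - 1) * zeta z = 1 + rem_series 1 z"
    using rem_series_eq[of z 1] zeta_is_zeta by (simp add: is_zeta_def fall_def)
qed (use assms in auto)

text \<open>
  The remainder is of order \<open>n powr (-Re s - 1)\<close>; it is compared with a difference of consecutive values of
  \<open>n powr (-Re s)\<close> so that tails can be summed by telescoping.
\<close>
lemma taylor_rem_one_bound:
  assumes n: "1 \<le> n" and s: "0 < Re s" "Re s \<le> 1"
  shows "norm (taylor_rem 1 n s)
    \<le> 4 * norm s * norm (s - 1) / Re s * (real n powr (- Re s) - real (Suc n) powr (- Re s))"
proof -
  define \<sigma> where "\<sigma> = Re s"
  have "\<exists>z. z > real n \<and> z < real (Suc n) \<and> real (Suc n) powr (-\<sigma>) - real n powr (-\<sigma>)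
      = (real (Suc n) - real n) * ((-\<sigma>) * z powr (-\<sigma> - 1))"
    using n by (intro MVT2) (auto intro!: derivative_eq_intros)
  then obtain z where z: "z > real n" "z < real (Suc n)"
    "real n powr (-\<sigma>) - real (Suc n) powr (-\<sigma>) = \<sigma> * z powr (-\<sigma> - 1)" by auto
  have "real n powr (-\<sigma> - 1) = 2 powr (\<sigma> + 1) * (2 * real n) powr (-\<sigma> - 1)"
    by (simp add: powr_mult flip: powr_add mult.assoc)
  also have "\<dots> \<le> 2 powr 2 * z powr (-\<sigma> - 1)"
    using z n s by (intro mult_mono powr_mono powr_mono2') (auto simp: \<sigma>_def)
  finally have "real n powr (-\<sigma> - 1) \<le> 4 / \<sigma> * (real n powr (-\<sigma>) - real (Suc n) powr (-\<sigma>))"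
    using s unfolding z(3) by (simp add: \<sigma>_def)
  hence "norm s * norm (s - 1) * real n powr (-\<sigma> - 1)
      \<le> norm s * norm (s - 1) * (4 / \<sigma> * (real n powr (-\<sigma>) - real (Suc n) powr (-\<sigma>)))"
    by (intro mult_left_mono) auto
  moreover have "norm (fall s (Suc 1)) = norm s * norm (s - 1)"
    by (simp add: fall_def norm_mult norm_minus_commute)
  hence "norm (taylor_rem 1 n s) \<le> norm s * norm (s - 1) * real n powr (-\<sigma> - 1)"
    using taylor_rem_bound[of n s 1] n s by (simp add: \<sigma>_def)
  ultimately have "norm (taylor_rem 1 n s)
      \<le> norm s * norm (s - 1) * (4 / \<sigma> * (real n powr (-\<sigma>) - real (Suc n) powr (-\<sigma>)))"
    by linarith
  thus ?thesis by (simp only: \<sigma>_def times_divide_eq_left times_divide_eq_right mult_ac)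
qed

lemma sum_taylor_rem_one:
  "(\<Sum>n<m. taylor_rem 1 (Suc n) s) = of_nat (Suc m) powr (1 - s) - 1 + (s - 1) * (\<Sum>n<m. of_nat (Suc n) powr (- s))"
proof (induction m)
  case (Suc m)
  have "taylor_rem 1 (Suc m) s = of_nat (Suc (Suc m)) powr (1 - s) - of_nat (Suc m) powr (1 - s)
      + (s - 1) * of_nat (Suc m) powr (- s)"
    by (simp add: taylor_rem_def fall_def algebra_simps)
  thus ?case unfolding sum.lessThan_Suc Suc.IH by (simp add: algebra_simps)
qed simp

text \<open>
  The partial sums of the series for \<open>(s - 1) * zeta s\<close> are \<open>(s - 1)\<close> times those of the Dirichlet series,
  up to the boundary term \<open>N powr (1 - s)\<close>.  The factor \<open>s - 1\<close> cancels from the bound for the tail.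
\<close>
lemma zeta_approx:
  assumes s: "0 < Re s" "Re s \<le> 1" "s \<noteq> 1" and N: "1 \<le> N"
  shows "norm (zeta s - (\<Sum>n\<in>{1..<N}. of_nat n powr (- s)))
     \<le> real N powr (1 - Re s) / norm (s - 1) + 4 * norm s / Re s * real N powr (- Re s)"
proof -
  obtain m where m: "N = Suc m" using N by (cases N) auto
  define c where "c = 4 * norm s * norm (s - 1) / Re s"
  define b where "b k n = real (Suc (n + k)) powr (- Re s)" for k n
  have b: "(\<lambda>n. b k n - b k (Suc n)) sums (b k 0 - 0)" for k
  proof (rule telescope_sums')
    show "b k \<longlonglongrightarrow> 0" unfolding b_def using s(1) by real_asymp
  qed
  have le: "norm (taylor_rem 1 (Suc (n + k)) s) \<le> c * (b k n - b k (Suc n))" for n k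
    using taylor_rem_one_bound[of "Suc (n + k)" s] s by (simp add: b_def c_def)
  have "summable (\<lambda>n. taylor_rem 1 (Suc n) s)"
  proof (rule summable_comparison_test'[where N = 0])
    show "summable (\<lambda>n. c * (b 0 n - b 0 (Suc n)))"
      by (intro summable_mult sums_summable[OF b])
    show "norm (taylor_rem 1 (Suc n) s) \<le> c * (b 0 n - b 0 (Suc n))" for n
      using le[of n 0] by simp
  qed
  define R where "R = (\<Sum>n. taylor_rem 1 (Suc (n + m)) s)"
  define P where "P = (\<Sum>n\<in>{1..<N}. of_nat n powr (- s))"
  have R: "norm R \<le> c * real N powr (- Re s)"
  proof -
    have "norm R \<le> (\<Sum>n. c * (b m n - b m (Suc n)))"
      unfolding R_def by (intro norm_suminf_le le summable_mult sums_summable[OF b])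
    also have "\<dots> = c * b m 0" using sums_unique[OF sums_mult[OF b[of m], of c]] by simp
    finally show ?thesis by (simp add: b_def m)
  qed
  have P: "P = (\<Sum>n<m. of_nat (Suc n) powr (- s))"
    unfolding P_def m by (rule sum.reindex_bij_witness[of _ Suc "\<lambda>n. n - 1"]) auto
  have "rem_series 1 s = R + (\<Sum>n<m. taylor_rem 1 (Suc n) s)"
    unfolding rem_series_def R_def
    using suminf_split_initial_segment[OF \<open>summable _\<close>, of m] by simp
  hence "(s - 1) * zeta s = R + of_nat N powr (1 - s) + (s - 1) * P"
    unfolding zeta_eq_rem_series[OF s(1,3)] sum_taylor_rem_one P m by simp
  hence "(s - 1) * (zeta s - P) = of_nat N powr (1 - s) + R"
    by (simp add: algebra_simps)
  hence "norm (s - 1) * norm (zeta s - P) = norm (of_nat N powr (1 - s) + R)"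
    by (metis norm_mult)
  also have "\<dots> \<le> norm (of_nat N powr (1 - s)) + norm R" by (rule norm_triangle_ineq)
  also have "norm (of_nat N powr (1 - s) :: complex) = real N powr (1 - Re s)"
    using N by (subst norm_powr_real_powr) auto
  finally have "norm (s - 1) * norm (zeta s - P) \<le> real N powr (1 - Re s) + c * real N powr (- Re s)"
    using R by simp
  hence "norm (zeta s - P) \<le> (real N powr (1 - Re s) + c * real N powr (- Re s)) / norm (s - 1)"
    using s(3) by (simp add: field_simps)
  also have "\<dots> = real N powr (1 - Re s) / norm (s - 1) + 4 * norm s / Re s * real N powr (- Re s)"
    using s(3) by (simp add: c_def add_divide_distrib)
  finally show ?thesis unfolding P_def .
qed

lemma sum_dyadic_blocks:
  fixes g :: "nat \<Rightarrow> complex"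
  shows "(\<Sum>n\<in>{1..<2 ^ J}. g n) = (\<Sum>j<J. \<Sum>n<2 ^ j. g (2 ^ j + n))"
proof (induction J)
  case (Suc J)
  have "{1..<2 ^ Suc J} = {1..<2 ^ J} \<union> {2 ^ J..<(2 ^ Suc J :: nat)}" by auto
  hence "(\<Sum>n\<in>{1..<2 ^ Suc J}. g n) = (\<Sum>n\<in>{1..<2 ^ J}. g n) + (\<Sum>n\<in>{2 ^ J..<2 ^ Suc J}. g n)"
    by (simp add: sum.union_disjoint)
  also have "(\<Sum>n\<in>{2 ^ J..<2 ^ Suc J}. g n) = (\<Sum>n<2 ^ J. g (2 ^ J + n))"
    by (rule sum.reindex_bij_witness[of _ "\<lambda>n. 2 ^ J + n" "\<lambda>n. n - 2 ^ J"]) auto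
  finally show ?case using Suc.IH by simp
qed simp

text \<open>
  A monomial in \<open>x\<close> and \<open>t\<close> is largest at the end of the range of \<open>x\<close> towards which it grows, and there it
  is a power of \<open>t\<close>.
\<close>
lemma powr_product_le:
  fixes x t :: real
  assumes "1 \<le> t" "0 < x" "(0 \<le> a \<and> x \<le> t powr b) \<or> (a \<le> 0 \<and> t powr b \<le> x)" "a * b + c \<le> d"
  shows "x powr a * t powr c \<le> t powr d"
proof -
  have "x powr a \<le> (t powr b) powr a"
    using assms(1,2,3) by (auto intro: powr_mono2 powr_mono2')
  hence "x powr a * t powr c \<le> (t powr b) powr a * t powr c" by (intro mult_right_mono) auto
  also have "\<dots> = t powr (a * b + c)" using assms(1) by (simp add: powr_powr powr_add mult.commute)
  also have "\<dots> \<le> t powr d" using assms(1,4) by (intro powr_mono)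
  finally show ?thesis .
qed

text \<open>
  After division by \<open>M powr (11/15)\<close> the first term of the \<open>k\<close>-th test decreases in \<open>M\<close> and fixes the lower end
  of its range, the second one increases in \<open>M\<close> and fixes the upper end.  For \<open>k = 4, 3, 2\<close> the lower
  ends at which the bound \<open>t powr (1/15)\<close> starts to hold are \<open>1/4\<close>, \<open>3/7\<close> and \<open>13/22\<close> in the exponent of \<open>t\<close>,
  and the resulting ranges overlap.
\<close>
lemma dyadic_block_bound:
  obtains C where "0 \<le> C"
    "\<And>s M. Re s = 11/15 \<Longrightarrow> 1 \<le> \<bar>Im s\<bar> \<Longrightarrow> 1 \<le> M \<Longrightarrow> real M \<le> \<bar>Im s\<bar> powr 2 \<Longrightarrow>
       norm (\<Sum>n<M. of_nat (M + n) powr (- s)) \<le> C * \<bar>Im s\<bar> powr (1/15)"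
proof -
  have v2: "vdc_bound 2 \<alpha> (1/2) 0 (20 * \<alpha>)" if "\<alpha> \<ge> 1" for \<alpha>
    using vdc_second_difference[OF that] .
  have v3: "vdc_bound 3 \<alpha> (1/6) (1/2) (4 * (1 + 20 * \<alpha>))" if "\<alpha> \<ge> 1" for \<alpha>
    using vdc_bound_step[OF v2[OF that]] that by (simp add: numeral_3_eq_3 numeral_2_eq_2)
  have v4: "vdc_bound 4 \<alpha> (1/14) (3/4) (4 * (1 + 4 * (1 + 20 * \<alpha>)))" if "\<alpha> \<ge> 1" for \<alpha>
    using vdc_bound_step[OF v3[OF that]] that by (simp add: eval_nat_numeral)
  obtain C2 where C2: "0 \<le> C2" "\<And>t M m. 0 < t \<Longrightarrow> 1 \<le> M \<Longrightarrow> m \<le> M \<Longrightarrow>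
      norm (\<Sum>n<m. ee (t / (2 * pi) * ln (real (M + n))))
        \<le> C2 * (real M powr (1 - real 2 * (1/2)) * t powr (1/2) + real M powr (0 + real 2 * (1/2)) * t powr (- (1/2)))"
    by (rule zeta_phase_sum_bound[OF v2[of "2 ^ 2"]]) auto
  obtain C3 where C3: "0 \<le> C3" "\<And>t M m. 0 < t \<Longrightarrow> 1 \<le> M \<Longrightarrow> m \<le> M \<Longrightarrow>
      norm (\<Sum>n<m. ee (t / (2 * pi) * ln (real (M + n))))
        \<le> C3 * (real M powr (1 - real 3 * (1/6)) * t powr (1/6) + real M powr (1/2 + real 3 * (1/6)) * t powr (- (1/6)))"
    by (rule zeta_phase_sum_bound[OF v3[of "2 ^ 3"]]) auto
  obtain C4 where C4: "0 \<le> C4" "\<And>t M m. 0 < t \<Longrightarrow> 1 \<le> M \<Longrightarrow> m \<le> M \<Longrightarrow>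
      norm (\<Sum>n<m. ee (t / (2 * pi) * ln (real (M + n))))
        \<le> C4 * (real M powr (1 - real 4 * (1/14)) * t powr (1/14) + real M powr (3/4 + real 4 * (1/14)) * t powr (- (1/14)))"
    by (rule zeta_phase_sum_bound[OF v4[of "2 ^ 4"]]) auto
  define C where "C = 1 + 2 * C2 + 2 * C3 + 2 * C4"
  show ?thesis
  proof
    show "0 \<le> C" using C2 C3 C4 by (simp add: C_def)
    fix s :: complex and M :: nat
    assume s: "Re s = 11/15" and t1: "1 \<le> \<bar>Im s\<bar>" and M: "1 \<le> M" and M2: "real M \<le> \<bar>Im s\<bar> powr 2"
    define t where "t = \<bar>Im s\<bar>"
    have t: "1 \<le> t" "0 < t" using t1 by (auto simp: t_def)
    define x where "x = real M"
    have x: "0 < x" using M by (simp add: x_def)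
    have block: "norm (\<Sum>n<M. of_nat (M + n) powr (- s)) \<le> x powr (-11/15) * B"
      if "\<And>m. m \<le> M \<Longrightarrow> norm (\<Sum>n<m. ee (t / (2 * pi) * ln (real (M + n)))) \<le> B" for B
      using norm_block_le[of M s B] that M s by (simp add: t_def x_def)
    have combine: "norm (\<Sum>n<M. of_nat (M + n) powr (- s)) \<le> C * t powr (1/15)"
      if "\<And>m. m \<le> M \<Longrightarrow> norm (\<Sum>n<m. ee (t / (2 * pi) * ln (real (M + n))))
            \<le> K * (x powr a1 * t powr c1 + x powr a2 * t powr c2)"
        and "x powr (a1 - 11/15) * t powr c1 \<le> t powr (1/15)" "x powr (a2 - 11/15) * t powr c2 \<le> t powr (1/15)"
        and "0 \<le> K" "2 * K \<le> C" for K a1 a2 c1 c2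
    proof -
      have "norm (\<Sum>n<M. of_nat (M + n) powr (- s)) \<le> x powr (-11/15) * (K * (x powr a1 * t powr c1 + x powr a2 * t powr c2))"
        by (rule block) (rule that(1))
      also have "\<dots> = K * (x powr (a1 - 11/15) * t powr c1 + x powr (a2 - 11/15) * t powr c2)"
      proof -
        have "x powr (a - 11/15) = x powr (-11/15) * x powr a" for a
          by (simp flip: powr_add)
        thus ?thesis by (simp only: distrib_left mult_ac)
      qed
      also have "\<dots> \<le> K * (t powr (1/15) + t powr (1/15))"
        by (intro mult_left_mono add_mono that(2-4))
      also have "\<dots> = (2 * K) * t powr (1/15)" by simp
      also have "\<dots> \<le> C * t powr (1/15)" by (intro mult_right_mono that(5)) simp
      finally show ?thesis .
    qed
    have "norm (\<Sum>n<M. of_nat (M + n) powr (- s)) \<le> C * t powr (1/15)"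
    proof -
      consider "x \<le> t powr (1/4)" | "t powr (1/4) \<le> x" "x \<le> t powr (3/7)"
        | "t powr (3/7) \<le> x" "x \<le> t powr (3/4)" | "t powr (3/4) \<le> x" "x \<le> t powr 2"
        using M2 unfolding t_def x_def by linarith
      thus ?thesis
      proof cases
        case 1
        have "norm (\<Sum>n<M. of_nat (M + n) powr (- s)) \<le> x powr (-11/15) * x"
        proof (rule block)
          fix m assume "m \<le> M"
          thus "norm (\<Sum>n<m. ee (t / (2 * pi) * ln (real (M + n)))) \<le> x"
            using norm_sum_ee_le[of "\<lambda>n. t / (2 * pi) * ln (real (M + n))" "{..<m}"] by (simp add: x_def)
        qed
        also have "\<dots> = x powr (4/15) * t powr 0"
          using x t powr_add[of x "-11/15" 1] by simp
        also have "\<dots> \<le> t powr (1/15)"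
          using 1 x t by (intro powr_product_le[where b = "1/4"]) auto
        also have "\<dots> \<le> C * t powr (1/15)"
          using C2 C3 C4 mult_right_mono[of 1 C "t powr (1/15)"] by (simp add: C_def)
        finally show ?thesis .
      next
        case 2
        show ?thesis
        proof (rule combine[where K = C4])
          show "x powr (1 - real 4 * (1/14) - 11/15) * t powr (1/14) \<le> t powr (1/15)"
            using 2 x t by (intro powr_product_le[where b = "1/4"]) auto
          show "x powr (3/4 + real 4 * (1/14) - 11/15) * t powr (- (1/14)) \<le> t powr (1/15)"
            using 2 x t by (intro powr_product_le[where b = "3/7"]) auto
        qed (use C2 C3 C4 M t in \<open>auto simp: x_def C_def\<close>)
      next
        case 3
        show ?thesis
        proof (rule combine[where K = C3])
          show "x powr (1 - real 3 * (1/6) - 11/15) * t powr (1/6) \<le> t powr (1/15)"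
            using 3 x t by (intro powr_product_le[where b = "3/7"]) auto
          show "x powr (1/2 + real 3 * (1/6) - 11/15) * t powr (- (1/6)) \<le> t powr (1/15)"
            using 3 x t by (intro powr_product_le[where b = "3/4"]) auto
        qed (use C2 C3 C4 M t in \<open>auto simp: x_def C_def\<close>)
      next
        case 4
        show ?thesis
        proof (rule combine[where K = C2])
          show "x powr (1 - real 2 * (1/2) - 11/15) * t powr (1/2) \<le> t powr (1/15)"
            using 4 x t by (intro powr_product_le[where b = "3/4"]) auto
          show "x powr (0 + real 2 * (1/2) - 11/15) * t powr (- (1/2)) \<le> t powr (1/15)"
            using 4 x t by (intro powr_product_le[where b = 2]) auto
        qed (use C2 C3 C4 M t in \<open>auto simp: x_def C_def\<close>)
      qed
    qed
    thus "norm (\<Sum>n<M. of_nat (M + n) powr (- s)) \<le> C * \<bar>Im s\<bar> powr (1/15)"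
      by (simp add: t_def)
  qed
qed

section \<open>Growth on the line of real part 11/15\<close>

text \<open>
  The length \<open>2 ^ J\<close> of the Dirichlet polynomial is the first power of two that reaches \<open>t\<^sup>2\<close>.  This is
  long enough for the error \<open>\<bar>s\<bar> * N powr (-11/15)\<close> and short enough for \<open>N powr (4/15) / t\<close> to stay bounded.
\<close>
lemma zeta_bound_large:
  obtains C where "0 \<le> C"
    "\<And>t. 1 \<le> \<bar>t\<bar> \<Longrightarrow> norm (zeta (11/15 + \<i> * of_real t)) \<le> C * (1 + 3 * ln \<bar>t\<bar>) * \<bar>t\<bar> powr (1/15)"
proof -
  obtain C where C: "0 \<le> C"
    "\<And>s M. Re s = 11/15 \<Longrightarrow> 1 \<le> \<bar>Im s\<bar> \<Longrightarrow> 1 \<le> M \<Longrightarrow> real M \<le> \<bar>Im s\<bar> powr 2 \<Longrightarrow>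
       norm (\<Sum>n<M. of_nat (M + n) powr (- s)) \<le> C * \<bar>Im s\<bar> powr (1/15)"
    using dyadic_block_bound by blast
  show ?thesis
  proof
    show "0 \<le> C + 13" using C by simp
    fix y :: real assume y: "1 \<le> \<bar>y\<bar>"
    define t where "t = \<bar>y\<bar>"
    have t: "1 \<le> t" "0 < t" using y by (auto simp: t_def)
    define s where "s = 11/15 + \<i> * of_real y"
    have s: "Re s = 11/15" "Im s = y" by (simp_all add: s_def)
    have T1: "1 \<le> t powr (1/15)" using t by (intro ge_one_powr_ge_zero) auto
    define J where "J = nat \<lceil>log 2 (t powr 2)\<rceil>"
    define N :: nat where "N = 2 ^ J"
    have L: "log 2 (t powr 2) = 2 * log 2 t" "0 \<le> log 2 t" using t by (simp_all add: log_def ln_realpow)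
    have J: "log 2 (t powr 2) \<le> real J" "real J < log 2 (t powr 2) + 1"
      using L unfolding J_def by linarith+
    have pow: "(2::real) ^ j = 2 powr real j" for j by (simp add: powr_realpow)
    have N1: "t powr 2 \<le> real N"
      using J(1) t unfolding N_def by (simp add: pow log_le_iff)
    have N2: "real N \<le> 2 * t powr 2"
    proof -
      have "real N \<le> 2 powr (log 2 (t powr 2) + 1)"
        using J(2) unfolding N_def by (simp add: pow)
      thus ?thesis using t by (simp add: powr_add)
    qed
    have small: "real (2 ^ j) \<le> t powr 2" if "j < J" for j
    proof -
      have "real j \<le> log 2 (t powr 2)" using that J(2) by linarith
      hence "2 powr real j \<le> t powr 2" using t by (simp add: le_log_iff)
      thus ?thesis by (simp add: pow)
    qed
    have main: "norm (\<Sum>n\<in>{1..<N}. of_nat n powr (- s)) \<le> (1 + 3 * ln t) * (C * t powr (1/15))"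
    proof -
      have "norm (\<Sum>n\<in>{1..<N}. of_nat n powr (- s)) \<le> (\<Sum>j<J. C * t powr (1/15))"
        unfolding N_def sum_dyadic_blocks
      proof (rule sum_norm_le)
        fix j assume "j \<in> {..<J}"
        thus "norm (\<Sum>n<2 ^ j. of_nat (2 ^ j + n) powr (- s)) \<le> C * t powr (1/15)"
          using C(2)[of s "2 ^ j"] small[of j] s y by (simp add: t_def)
      qed
      also have "\<dots> = real J * (C * t powr (1/15))" by simp
      also have "\<dots> \<le> (1 + 3 * ln t) * (C * t powr (1/15))"
      proof (intro mult_right_mono)
        have "2 * ln t \<le> 3 * ln t * ln 2"
          using ln2_ge_two_thirds t mult_left_mono[of "2/3" "ln 2" "3 * ln t"] by simp
        hence "2 * log 2 t \<le> 3 * ln t" by (simp add: log_def field_simps)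
        thus "real J \<le> 1 + 3 * ln t" using J(2) L(1) by linarith
      qed (use C in auto)
      finally show ?thesis .
    qed
    have e1: "real N powr (1 - Re s) / norm (s - 1) \<le> 2"
    proof -
      have "real N powr (4/15) \<le> (2 * t powr 2) powr (4/15)"
        using N2 by (intro powr_mono2) auto
      also have "\<dots> = 2 powr (4/15) * t powr (8/15)" unfolding powr_mult powr_powr by simp
      also have "\<dots> \<le> 2 powr 1 * t powr 1" using t by (intro mult_mono powr_mono) auto
      also have "4/15 = 1 - Re s" using s by simp
      finally have "real N powr (1 - Re s) \<le> 2 * t" using t by simp
      moreover have "t \<le> norm (s - 1)" using abs_Im_le_cmod[of "s - 1"] s by (simp add: t_def)
      ultimately have "real N powr (1 - Re s) \<le> 2 * norm (s - 1)" by linarith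
      thus ?thesis using \<open>t \<le> norm (s - 1)\<close> t by (simp add: divide_le_eq)
    qed
    have e2: "4 * norm s / Re s * real N powr (- Re s) \<le> 11"
    proof -
      have "norm s \<le> 2 * t" using cmod_le[of s] s t by (simp add: t_def)
      have "real N powr (- Re s) \<le> (t powr 2) powr (- Re s)"
        using N1 t s by (intro powr_mono2') auto
      also have "\<dots> = t powr (- (22/15))" unfolding powr_powr s(1) by simp
      also have "\<dots> \<le> t powr (- 1)" using t by (intro powr_mono) auto
      finally have "real N powr (- Re s) \<le> t powr (- 1)" .
      hence "4 * norm s / Re s * real N powr (- Re s) \<le> 4 * (2 * t) / (11/15) * t powr (- 1)"
        unfolding s(1) using \<open>norm s \<le> 2 * t\<close> t by (intro mult_mono divide_right_mono) auto
      also have "\<dots> \<le> 11" using t by (simp add: powr_minus field_simps)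
      finally show ?thesis .
    qed
    have "norm (zeta s - (\<Sum>n\<in>{1..<N}. of_nat n powr (- s))) \<le> 13"
    proof -
      have "s \<noteq> 1" using s by auto
      hence "norm (zeta s - (\<Sum>n\<in>{1..<N}. of_nat n powr (- s)))
          \<le> real N powr (1 - Re s) / norm (s - 1) + 4 * norm s / Re s * real N powr (- Re s)"
        using s by (intro zeta_approx) (auto simp: N_def)
      thus ?thesis using e1 e2 by linarith
    qed
    hence "norm (zeta s) \<le> (1 + 3 * ln t) * (C * t powr (1/15)) + 13"
      using main norm_triangle_ineq2[of "zeta s" "\<Sum>n\<in>{1..<N}. of_nat n powr (- s)"] by linarith
    also have "13 \<le> (1 + 3 * ln t) * (13 * t powr (1/15))"
      using T1 t mult_mono[of 1 "1 + 3 * ln t" 13 "13 * t powr (1/15)"] by simp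
    finally show "norm (zeta (11/15 + \<i> * of_real y)) \<le> (C + 13) * (1 + 3 * ln \<bar>y\<bar>) * \<bar>y\<bar> powr (1/15)"
      by (simp add: s_def t_def algebra_simps)
  qed
qed

lemma zeta_bounded_on_segment:
  "\<exists>B. \<forall>t. \<bar>t\<bar> \<le> 1 \<longrightarrow> norm (zeta (11/15 + \<i> * of_real t)) \<le> B"
proof -
  have "continuous_on {-1..1} (\<lambda>t. zeta (11/15 + \<i> * of_real t))"
  proof (rule continuous_on_compose2[OF holomorphic_on_imp_continuous_on[OF holomorphic_zeta]])
    show "(\<lambda>t. 11/15 + \<i> * of_real t) ` {-1..1} \<subseteq> UNIV - {1}"
      by (auto simp: complex_eq_iff)
  qed (intro continuous_intros)
  hence "bounded ((\<lambda>t. zeta (11/15 + \<i> * of_real t)) ` {-1..1})"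
    by (intro compact_imp_bounded compact_continuous_image) auto
  then obtain B where "\<forall>z\<in>(\<lambda>t. zeta (11/15 + \<i> * of_real t)) ` {-1..1}. norm z \<le> B"
    unfolding bounded_iff ..
  thus ?thesis by (intro exI[of _ B]) (auto simp: abs_le_iff)
qed

lemma zeta_growth:
  assumes "0 < \<epsilon>"
  shows "\<exists>C. \<forall>t. norm (zeta (11/15 + \<i> * of_real t)) \<le> C * (\<bar>t\<bar> + 1) powr (1/15 + \<epsilon>)"
proof -
  obtain C where C: "0 \<le> C"
    "\<And>t. 1 \<le> \<bar>t\<bar> \<Longrightarrow> norm (zeta (11/15 + \<i> * of_real t)) \<le> C * (1 + 3 * ln \<bar>t\<bar>) * \<bar>t\<bar> powr (1/15)"
    using zeta_bound_large by blast
  obtain B where B: "\<And>t. \<bar>t\<bar> \<le> 1 \<Longrightarrow> norm (zeta (11/15 + \<i> * of_real t)) \<le> B"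
    using zeta_bounded_on_segment by blast
  have B0: "0 \<le> B" using order_trans[OF norm_ge_zero B[of 0]] by simp
  define K where "K = B + C * (1 + 3 / \<epsilon>)"
  have "norm (zeta (11/15 + \<i> * of_real t)) \<le> K * (\<bar>t\<bar> + 1) powr (1/15 + \<epsilon>)" for t
  proof (cases "\<bar>t\<bar> \<le> 1")
    case True
    have "1 \<le> (\<bar>t\<bar> + 1) powr (1/15 + \<epsilon>)" using assms by (intro ge_one_powr_ge_zero) auto
    moreover have "0 \<le> C * (1 + 3 / \<epsilon>)" using C(1) assms by simp
    ultimately have "B * 1 \<le> K * (\<bar>t\<bar> + 1) powr (1/15 + \<epsilon>)"
      using B0 by (intro mult_mono) (auto simp: K_def)
    thus ?thesis using B[OF True] by simp
  next
    case False
    hence t: "1 \<le> \<bar>t\<bar>" by simp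
    have "1 \<le> \<bar>t\<bar> powr \<epsilon>" using t assms by (intro ge_one_powr_ge_zero) auto
    moreover have "ln \<bar>t\<bar> \<le> \<bar>t\<bar> powr \<epsilon> / \<epsilon>" using t assms by (rule ln_powr_bound)
    ultimately have "1 + 3 * ln \<bar>t\<bar> \<le> (1 + 3 / \<epsilon>) * \<bar>t\<bar> powr \<epsilon>" by (simp add: algebra_simps)
    hence "C * (1 + 3 * ln \<bar>t\<bar>) * \<bar>t\<bar> powr (1/15) \<le> C * ((1 + 3 / \<epsilon>) * \<bar>t\<bar> powr \<epsilon>) * \<bar>t\<bar> powr (1/15)"
      using C(1) by (intro mult_right_mono mult_left_mono) auto
    also have "\<dots> = C * (1 + 3 / \<epsilon>) * \<bar>t\<bar> powr (1/15 + \<epsilon>)"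
      by (simp add: powr_add mult_ac)
    also have "\<dots> \<le> K * (\<bar>t\<bar> + 1) powr (1/15 + \<epsilon>)"
      using C(1) B0 assms by (intro mult_mono powr_mono2) (auto simp: K_def)
    finally show ?thesis using C(2)[OF t] by linarith
  qed
  thus ?thesis by blast
qed

theorem theorem11p2:
  shows "(\<forall>\<epsilon>>0. \<exists>C::real. \<forall>t::real.
            norm (zeta (11/15 + \<i> * complex_of_real t)) \<le> C * (\<bar>t\<bar> + 1) powr (1/15 + \<epsilon>))
         \<and> lindelof_mu (11/15) \<le> ereal (1/15)"
proof
  show "\<forall>\<epsilon>>0. \<exists>C::real. \<forall>t::real.
            norm (zeta (11/15 + \<i> * complex_of_real t)) \<le> C * (\<bar>t\<bar> + 1) powr (1/15 + \<epsilon>)"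
    using zeta_growth by blast
  show "lindelof_mu (11/15) \<le> ereal (1/15)"
  proof (rule ereal_le_epsilon2)
    fix \<epsilon> :: real assume \<epsilon>: "0 < \<epsilon>"
    obtain C where C: "\<And>t. norm (zeta (11/15 + \<i> * of_real t)) \<le> C * (\<bar>t\<bar> + 1) powr (1/15 + \<epsilon>)"
      using zeta_growth[OF \<epsilon>] by blast
    have C0: "0 \<le> C" using order_trans[OF norm_ge_zero C[of 0]] by simp
    have "(\<lambda>t::real. norm (zeta (of_real (11/15) + \<i> * of_real t))) \<in> O[at_infinity](\<lambda>t. \<bar>t\<bar> powr (1/15 + \<epsilon>))"
    proof (rule landau_o.bigI)
      show "0 < C * 2 powr (1/15 + \<epsilon>) + 1" using C0 by (simp add: add_nonneg_pos)
      have "norm (norm (zeta (of_real (11/15) + \<i> * of_real t)))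
          \<le> (C * 2 powr (1/15 + \<epsilon>) + 1) * norm (\<bar>t\<bar> powr (1/15 + \<epsilon>))" if t: "1 \<le> norm t" for t :: real
      proof -
        have "norm (zeta (of_real (11/15) + \<i> * of_real t)) \<le> C * (\<bar>t\<bar> + 1) powr (1/15 + \<epsilon>)"
          using C[of t] by simp
        also have "\<dots> \<le> C * (2 * \<bar>t\<bar>) powr (1/15 + \<epsilon>)"
          using t \<epsilon> C0 by (intro mult_left_mono powr_mono2) auto
        also have "\<dots> = (C * 2 powr (1/15 + \<epsilon>)) * \<bar>t\<bar> powr (1/15 + \<epsilon>)"
          by (simp add: powr_mult)
        also have "\<dots> \<le> (C * 2 powr (1/15 + \<epsilon>) + 1) * \<bar>t\<bar> powr (1/15 + \<epsilon>)"
          by (intro mult_right_mono) auto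
        finally show ?thesis by simp
      qed
      thus "\<forall>\<^sub>F t :: real in at_infinity. norm (norm (zeta (of_real (11/15) + \<i> * of_real t)))
          \<le> (C * 2 powr (1/15 + \<epsilon>) + 1) * norm (\<bar>t\<bar> powr (1/15 + \<epsilon>))"
        unfolding eventually_at_infinity by blast
    qed
    hence "lindelof_mu (11/15) \<le> ereal (1/15 + \<epsilon>)"
      unfolding lindelof_mu_def by (intro Inf_lower imageI CollectI)
    thus "lindelof_mu (11/15) \<le> ereal (1/15) + ereal \<epsilon>" by simp
  qed
qed

end
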